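(* Let $\alpha,\beta\ge0$. The product measure $\mu^{\mathbb{Z}}$ satisfies $\mathcal{T}^{(\alpha,\beta)}_{dK}\mu^{\mathbb{Z}}=\mu^{\mathbb{Z}}$ for the following $\mu$: (a) if $\alpha=\beta$: any probability measure $\mu$ on $(0,\infty)$; (b) if $\alpha>0$, $\beta=0$: $\mu=\mathrm{GIG}(\lambda,c\alpha,c)$ for any $\lambda,c>0$ such that $2\int\log(x)\,\mu(dx)<-\log\alpha$; (c) if $\alpha=0$, $\beta>0$: $\mu=\mathrm{IG}(\lambda,c)$ for any $\lambda,c>0$ such that $2\int\log(x)\,\mu(dx)<-\log\beta$.
   Context: $F^{(\alpha,\beta)}_{dK}(x,u):=\left(\frac{u(1+\beta xu)}{1+\alpha xu},\frac{x(1+\alpha xu)}{1+\beta xu}\right)$ on $(0,\infty)^2$, an involution. The dynamics $\mathcal{T}^{(\alpha,\beta)}_{dK}$ on $(0,\infty)^{\mathbb{Z}}$: for configurations $x=(x_n)$ for which either there is a unique family $(x_n^t,u_n^t)_{n,t\in\mathbb{Z}}$ with $F^{(\alpha,\beta)}_{dK}(x_n^t,u_{n-1}^t)=(x_n^{t+1},u_n^t)$ for all $n,t$ and $x_n^0=x_n$, or a unique sequence $(U_n)\in(0,\infty)^{\mathbb{Z}}$ with $(F^{(\alpha,\beta)}_{dK})^{(2)}(x_n,U_{n-1})=U_n$ for all $n$, set $\mathcal{T}(x)_n:=(F^{(\alpha,\beta)}_{dK})^{(1)}(x_n,U_{n-1})$ (with $U_n=u_n^0$); invariance includes that $\mathcal{T}$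 is a.s. defined. $\mathrm{GIG}(\lambda,c_1,c_2)$ has density proportional to $x^{-\lambda-1}e^{-c_1x-c_2x^{-1}}$ on $(0,\infty)$; $\mathrm{IG}(\lambda,c)$ has density proportional to $x^{-\lambda-1}e^{-cx^{-1}}$ on $(0,\infty)$. *)

theory Defs
  imports "HOL-Probability.Probability"
begin

definition F_dK :: "real \<Rightarrow> real \<Rightarrow> real \<Rightarrow> real \<Rightarrow> real \<times> real" where
  "F_dK \<alpha> \<beta> x u =
     (u * (1 + \<beta> * x * u) / (1 + \<alpha> * x * u), x * (1 + \<alpha> * x * u) / (1 + \<beta> * x * u))"

definition dK_lattice_sol ::
  "real \<Rightarrow> real \<Rightarrow> (int \<Rightarrow> real) \<Rightarrow> (int \<Rightarrow> int \<Rightarrow> real) \<times> (int \<Rightarrow> int \<Rightarrow> real) \<Rightarrow> bool" where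
  "dK_lattice_sol \<alpha> \<beta> x p =
     ((\<forall>n t. fst p n t > 0 \<and> snd p n t > 0) \<and>
      (\<forall>n t. F_dK \<alpha> \<beta> (fst p n t) (snd p (n - 1) t) = (fst p n (t + 1), snd p n t)) \<and>
      (\<forall>n. fst p n 0 = x n))"

definition dK_carrier_sol :: "real \<Rightarrow> real \<Rightarrow> (int \<Rightarrow> real) \<Rightarrow> (int \<Rightarrow> real) \<Rightarrow> bool" where
  "dK_carrier_sol \<alpha> \<beta> x U =
     ((\<forall>n. U n > 0) \<and> (\<forall>n. snd (F_dK \<alpha> \<beta> (x n) (U (n - 1))) = U n))"

definition dK_defined :: "real \<Rightarrow> real \<Rightarrow> (int \<Rightarrow> real) \<Rightarrow> bool" where
  "dK_defined \<alpha> \<beta> x =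
     ((\<forall>n. x n > 0) \<and>
      ((\<exists>!p. dK_lattice_sol \<alpha> \<beta> x p) \<or> (\<exists>!U. dK_carrier_sol \<alpha> \<beta> x U)))"

definition dK_U :: "real \<Rightarrow> real \<Rightarrow> (int \<Rightarrow> real) \<Rightarrow> int \<Rightarrow> real" where
  "dK_U \<alpha> \<beta> x =
     (if \<exists>!p. dK_lattice_sol \<alpha> \<beta> x p
      then (\<lambda>n. snd (THE p. dK_lattice_sol \<alpha> \<beta> x p) n 0)
      else (THE U. dK_carrier_sol \<alpha> \<beta> x U))"

text \<open>The dynamics T; on configurations where it is not defined it is set to the identity
  (irrelevant, since invariance requires T to be defined almost surely).\<close>
definition dK_T :: "real \<Rightarrow> real \<Rightarrow> (int \<Rightarrow> real) \<Rightarrow> int \<Rightarrow> real" where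
  "dK_T \<alpha> \<beta> x =
     (if dK_defined \<alpha> \<beta> x
      then (\<lambda>n. fst (F_dK \<alpha> \<beta> (x n) (dK_U \<alpha> \<beta> x (n - 1))))
      else x)"

definition dK_invariant :: "real \<Rightarrow> real \<Rightarrow> real measure \<Rightarrow> bool" where
  "dK_invariant \<alpha> \<beta> \<mu> =
     ((AE x in PiM UNIV (\<lambda>_::int. \<mu>). dK_defined \<alpha> \<beta> x) \<and>
      distr (PiM UNIV (\<lambda>_::int. \<mu>)) (PiM UNIV (\<lambda>_::int. \<mu>)) (dK_T \<alpha> \<beta>)
        = PiM UNIV (\<lambda>_::int. \<mu>))"

definition normalized_density :: "(real \<Rightarrow> real) \<Rightarrow> real measure" where
  "normalized_density f = density lborel (\<lambda>x. ennreal (f x / (LINT y|lborel. f y)))"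

definition GIG :: "real \<Rightarrow> real \<Rightarrow> real \<Rightarrow> real measure" where
  "GIG lam c1 c2 = normalized_density
     (\<lambda>x. if x > 0 then x powr (- lam - 1) * exp (- c1 * x - c2 / x) else 0)"

definition IG :: "real \<Rightarrow> real \<Rightarrow> real measure" where
  "IG lam c = normalized_density
     (\<lambda>x. if x > 0 then x powr (- lam - 1) * exp (- c / x) else 0)"

end

(* A carrier is a solution U of U n = Fu (x n) (U (n - 1)); the distinguished one, limit_carrier x, is
   the limit of the iterations started from 0 ever further to the left. Since Fu x is Lipschitz with
   constant |alpha - beta| x^2, the iterations converge, to the same limit from every positive
   starting value, as soon as the products of these constants decay; the bound on the mean of ln gives
   this almost surely, because some small power s satisfies E (gamma x^2)^s < 1.

   The dynamics are defined exactly where carriers are unique (alpha <= beta), respectively where all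
   forward and backward iterates of x have convergent iterations (beta = 0): in the latter case
   carriers are never unique, but a non-minimal one leads to a configuration without any carrier, so
   the lattice solution is unique if it exists. Both conditions are measurable.

   Invariance is Burke's argument: F preserves mu x nu for a suitable nu (mu itself if alpha = beta,
   IG for GIG and vice versa), hence limit_carrier x n has law nu, and pushing mu x nu through F site
   by site shows that the transformed configuration is again i.i.d. with law mu. *)
theory Submission
  imports Defs
begin

section \<open>Carriers and lattice solutions\<close>

text \<open>Transporting a law by \<open>distr\<close> presupposes a measurable map, so
  \<open>dK_T\<close> has to be identified on every configuration and not just almost surely; hence
  the exact descriptions of its domain. Uniqueness of a lattice solution also concerns past times.
  As F is an involution, the past of a configuration is the future of its mirror image, and a
  product measure is invariant under reflection, so statements about forward times suffice. The law
  of the distinguished carrier cannot be read off the iterations from 0. Started instead from an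
  independent value with law nu, they keep this law at every stage, and the limit does not depend on
  the start. Fractional moments are used because an IG law with small lambda has no first moment,
  and because a single finite expectation yields the convergence of a whole series.\<close>

locale dK =
  fixes \<alpha> \<beta> :: real
  assumes \<alpha>_nonneg: "0 \<le> \<alpha>" and \<beta>_nonneg: "0 \<le> \<beta>"
begin

definition Fx :: "real \<Rightarrow> real \<Rightarrow> real" where
  "Fx x u = u * (1 + \<beta> * x * u) / (1 + \<alpha> * x * u)"

definition Fu :: "real \<Rightarrow> real \<Rightarrow> real" where
  "Fu x u = x * (1 + \<alpha> * x * u) / (1 + \<beta> * x * u)"

lemma F_dK_eq: "F_dK \<alpha> \<beta> x u = (Fx x u, Fu x u)"
  by (simp add: F_dK_def Fx_def Fu_def)

lemma den_pos:
  assumes "0 < x" "0 \<le> u"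
  shows "0 < 1 + \<alpha> * x * u" "0 < 1 + \<beta> * x * u"
  using assms \<alpha>_nonneg \<beta>_nonneg by (simp_all add: add_pos_nonneg)

lemma Fu_pos: "0 < x \<Longrightarrow> 0 \<le> u \<Longrightarrow> 0 < Fu x u"
  using den_pos[of x u] by (simp add: Fu_def)

lemma Fx_pos: "0 < x \<Longrightarrow> 0 < u \<Longrightarrow> 0 < Fx x u"
  using den_pos[of x u] by (simp add: Fx_def)

text \<open>The product of the two components is conserved, so both applications of F use the same
  two factors, and the second application cancels the first.\<close>

lemma F_involution:
  assumes "0 < x" "0 < u"
  shows "Fx (Fx x u) (Fu x u) = x" "Fu (Fx x u) (Fu x u) = u"
proof -
  note d = den_pos[OF assms(1) less_imp_le[OF assms(2)]]
  have p: "Fx x u * Fu x u = x * u"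
    using d by (simp add: Fx_def Fu_def)
  have "Fx (Fx x u) (Fu x u) = Fu x u * (1 + \<beta> * (Fx x u * Fu x u)) / (1 + \<alpha> * (Fx x u * Fu x u))"
    by (simp add: Fx_def[of "Fx x u"] mult.assoc)
  then show "Fx (Fx x u) (Fu x u) = x"
    unfolding p using d by (simp add: Fu_def mult.assoc)
  have "Fu (Fx x u) (Fu x u) = Fx x u * (1 + \<alpha> * (Fx x u * Fu x u)) / (1 + \<beta> * (Fx x u * Fu x u))"
    by (simp add: Fu_def[of "Fx x u"] mult.assoc)
  then show "Fu (Fx x u) (Fu x u) = u"
    unfolding p using d by (simp add: Fx_def mult.assoc)
qed

text \<open>The exact formula serves twice: the sign of \<alpha> - \<beta> gives monotonicity in
  \<open>u\<close>, and dropping the denominators, which are at least 1, gives the Lipschitz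
  bound.\<close>

lemma Fu_diff:
  assumes "0 < x" "0 \<le> u" "0 \<le> v"
  shows "Fu x u - Fu x v = (\<alpha> - \<beta>) * x\<^sup>2 * (u - v) / ((1 + \<beta> * x * u) * (1 + \<beta> * x * v))"
  using den_pos(2)[OF assms(1,2)] den_pos(2)[OF assms(1,3)]
  by (simp add: Fu_def divide_simps) (simp add: algebra_simps power2_eq_square)

lemma Fu_lipschitz:
  assumes "0 < x" "0 \<le> u" "0 \<le> v"
  shows "\<bar>Fu x u - Fu x v\<bar> \<le> \<bar>\<alpha> - \<beta>\<bar> * x\<^sup>2 * \<bar>u - v\<bar>"
proof -
  have "1 \<le> 1 + \<beta> * x * u" "1 \<le> 1 + \<beta> * x * v"
    using assms \<beta>_nonneg by simp_all
  then have "1 \<le> (1 + \<beta> * x * u) * (1 + \<beta> * x * v)"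
    by (metis mult_mono mult_1 zero_le_one order_trans)
  moreover have "\<bar>a / d\<bar> \<le> \<bar>a\<bar>" if "1 \<le> d" for a d :: real
    using that by (simp add: abs_divide divide_le_eq mult_le_cancel_left1)
  ultimately have "\<bar>Fu x u - Fu x v\<bar> \<le> \<bar>(\<alpha> - \<beta>) * x\<^sup>2 * (u - v)\<bar>"
    unfolding Fu_diff[OF assms] by blast
  then show ?thesis by (simp add: abs_mult)
qed

text \<open>The value \<open>u\<close> is placed at site \<open>n - k\<close>. The site of
  evaluation stays fixed while the start recedes to the left.\<close>

primrec carrier_from :: "real \<Rightarrow> nat \<Rightarrow> (int \<Rightarrow> real) \<Rightarrow> int \<Rightarrow> real" where
  "carrier_from u 0 x n = u"
| "carrier_from u (Suc k) x n = Fu (x n) (carrier_from u k x (n - 1))"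

text \<open>Splitting off the leftmost step instead of the rightmost one presents consecutive
  iterates as iterates of equal length with different starts, to which
  \<open>carrier_from_diff\<close> applies.\<close>

lemma carrier_from_Suc_inner:
  "carrier_from u (Suc k) x n = carrier_from (Fu (x (n - int k)) u) k x n"
proof (induction k arbitrary: n)
  case (Suc k)
  have "n - 1 - int k = n - int (Suc k)" by simp
  then show ?case using Suc[of "n - 1"] by (metis carrier_from.simps(2))
qed simp

text \<open>Causality of the recursion; the independence used in Burke's argument rests on
  it.\<close>

lemma carrier_from_cong:
  "(\<And>m. m \<le> n \<Longrightarrow> x m = y m) \<Longrightarrow> carrier_from u k x n = carrier_from u k y n"
  by (induction k arbitrary: n) simp_all

lemma carrier_from_nonneg:
  "(\<And>n. 0 < x n) \<Longrightarrow> 0 \<le> u \<Longrightarrow> 0 \<le> carrier_from u k x n"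
  by (induction k arbitrary: n) (simp_all add: Fu_pos less_imp_le)

lemma carrier_from_diff:
  assumes "\<And>n. 0 < x n" "0 \<le> u" "0 \<le> v"
  shows "\<bar>carrier_from u k x n - carrier_from v k x n\<bar>
    \<le> (\<Prod>j<k. \<bar>\<alpha> - \<beta>\<bar> * (x (n - int j))\<^sup>2) * \<bar>u - v\<bar>"
proof (induction k arbitrary: n)
  case (Suc k)
  have "\<bar>carrier_from u (Suc k) x n - carrier_from v (Suc k) x n\<bar>
      \<le> \<bar>\<alpha> - \<beta>\<bar> * (x n)\<^sup>2 * \<bar>carrier_from u k x (n - 1) - carrier_from v k x (n - 1)\<bar>"
    using Fu_lipschitz[OF assms(1)] assms carrier_from_nonneg[of x] by simp
  also have "\<dots> \<le> \<bar>\<alpha> - \<beta>\<bar> * (x n)\<^sup>2 *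
      ((\<Prod>j<k. \<bar>\<alpha> - \<beta>\<bar> * (x (n - 1 - int j))\<^sup>2) * \<bar>u - v\<bar>)"
    by (intro mult_left_mono Suc) simp
  also have "\<dots> = (\<Prod>j<Suc k. \<bar>\<alpha> - \<beta>\<bar> * (x (n - int j))\<^sup>2) * \<bar>u - v\<bar>"
    by (subst prod.lessThan_Suc_shift) (simp add: algebra_simps)
  finally show ?case .
qed simp

text \<open>Positivity is included because \<open>dK_defined\<close> demands it too, so that the two
  can be compared on all configurations.\<close>

definition carrier_convergent :: "(int \<Rightarrow> real) \<Rightarrow> bool" where
  "carrier_convergent x \<longleftrightarrow> (\<forall>n. 0 < x n) \<and> (\<forall>n. convergent (\<lambda>k. carrier_from 0 k x n))"

text \<open>The start 0 lies below every carrier. Hence the iterates can be compared with all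
  carriers: from below when the recursion is increasing, alternately from below and above when it is
  antitone.\<close>

definition limit_carrier :: "(int \<Rightarrow> real) \<Rightarrow> int \<Rightarrow> real" where
  "limit_carrier x n = lim (\<lambda>k. carrier_from 0 k x n)"

lemma limit_carrier_cong: "(\<And>m. m \<le> n \<Longrightarrow> x m = y m) \<Longrightarrow> limit_carrier x n = limit_carrier y n"
  unfolding limit_carrier_def using carrier_from_cong[of n x y 0] by presburger

lemma limit_carrier_LIMSEQ: "carrier_convergent x \<Longrightarrow> (\<lambda>k. carrier_from 0 k x n) \<longlonglongrightarrow> limit_carrier x n"
  by (simp add: carrier_convergent_def limit_carrier_def convergent_LIMSEQ_iff)

lemma tendsto_Fu:
  assumes "f \<longlonglongrightarrow> l" "0 < x" "0 \<le> l"
  shows "(\<lambda>k. Fu x (f k)) \<longlonglongrightarrow> Fu x l"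
  unfolding Fu_def using den_pos(2)[OF assms(2,3)]
  by (intro tendsto_intros assms) simp

lemma carrier_solI:
  assumes "\<And>n. 0 < U n" "\<And>n. U n = Fu (x n) (U (n - 1))"
  shows "dK_carrier_sol \<alpha> \<beta> x U"
  using assms unfolding dK_carrier_sol_def F_dK_eq by (metis snd_conv)

lemma carrier_solD:
  assumes "dK_carrier_sol \<alpha> \<beta> x U"
  shows "0 < U n" "U n = Fu (x n) (U (n - 1))"
  using assms unfolding dK_carrier_sol_def F_dK_eq by (metis snd_conv)+

lemma limit_carrier_sol:
  assumes "carrier_convergent x"
  shows "dK_carrier_sol \<alpha> \<beta> x (limit_carrier x)"
proof (rule carrier_solI)
  have pos: "0 < x n" for n using assms by (simp add: carrier_convergent_def)
  have V0: "0 \<le> limit_carrier x n" for n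
    using limit_carrier_LIMSEQ[OF assms] by (rule LIMSEQ_le_const) (use carrier_from_nonneg pos in auto)
  show eq: "limit_carrier x n = Fu (x n) (limit_carrier x (n - 1))" for n
  proof (rule LIMSEQ_unique)
    show "(\<lambda>k. carrier_from 0 (Suc k) x n) \<longlonglongrightarrow> limit_carrier x n"
      using limit_carrier_LIMSEQ[OF assms] by (rule LIMSEQ_Suc)
    show "(\<lambda>k. carrier_from 0 (Suc k) x n) \<longlonglongrightarrow> Fu (x n) (limit_carrier x (n - 1))"
      by (simp add: tendsto_Fu limit_carrier_LIMSEQ assms pos V0)
  qed
  show "0 < limit_carrier x n" for n
    unfolding eq[of n] by (rule Fu_pos[OF pos V0])
qed

text \<open>Since \<open>Fu x 0 = x\<close>, consecutive iterates differ only by starting from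
  \<open>x (n - int k)\<close> or from 0. The telescoping series is therefore dominated by the one
  in \<open>sm\<close>, and \<open>lim\<close> removes the influence of any other start.\<close>

lemma carrier_from_convergence:
  assumes pos: "\<And>n. 0 < x n"
    and sm: "\<And>n. summable (\<lambda>k. x (n - int k) * (\<Prod>j<k. \<bar>\<alpha> - \<beta>\<bar> * (x (n - int j))\<^sup>2))"
    and lim: "\<And>n. (\<lambda>k. \<Prod>j<k. \<bar>\<alpha> - \<beta>\<bar> * (x (n - int j))\<^sup>2) \<longlonglongrightarrow> 0"
  shows "carrier_convergent x" "0 \<le> u \<Longrightarrow> (\<lambda>k. carrier_from u k x n) \<longlonglongrightarrow> limit_carrier x n"
proof -
  let ?p = "\<lambda>n k. \<Prod>j<k. \<bar>\<alpha> - \<beta>\<bar> * (x (n - int j))\<^sup>2"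
  have "convergent (\<lambda>k. carrier_from 0 k x n)" for n
  proof -
    have "norm (carrier_from 0 (Suc k) x n - carrier_from 0 k x n) \<le> x (n - int k) * ?p n k" for k
    proof -
      have "carrier_from 0 (Suc k) x n = carrier_from (x (n - int k)) k x n"
        unfolding carrier_from_Suc_inner by (simp add: Fu_def)
      then show ?thesis
        using carrier_from_diff[OF pos, where u="x (n - int k)" and v=0 and k=k and n=n]
          pos[of "n - int k"]
        by (simp add: mult.commute)
    qed
    then have "summable (\<lambda>k. carrier_from 0 (Suc k) x n - carrier_from 0 k x n)"
      by (intro summable_comparison_test'[OF sm[of n], where N=0])
    then have "convergent (\<lambda>m. \<Sum>k<m. carrier_from 0 (Suc k) x n - carrier_from 0 k x n)"
      by (simp add: summable_iff_convergent)
    then show ?thesis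
      unfolding sum_lessThan_telescope[of "\<lambda>k. carrier_from 0 k x n"] by simp
  qed
  then show g: "carrier_convergent x"
    using pos by (simp add: carrier_convergent_def)
  assume u: "0 \<le> u"
  have "(\<lambda>k. carrier_from u k x n - carrier_from 0 k x n) \<longlonglongrightarrow> 0"
  proof (rule Lim_null_comparison)
    show "\<forall>\<^sub>F k in sequentially. norm (carrier_from u k x n - carrier_from 0 k x n) \<le> ?p n k * u"
      using carrier_from_diff[where x=x and n=n and u=u and v=0, OF pos u] u by simp
    show "(\<lambda>k. ?p n k * u) \<longlonglongrightarrow> 0"
      by (intro tendsto_mult_left_zero lim)
  qed
  from tendsto_add[OF this limit_carrier_LIMSEQ[OF g, of n]]
  show "(\<lambda>k. carrier_from u k x n) \<longlonglongrightarrow> limit_carrier x n" by simp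
qed

section \<open>Lattice solutions as pairs of forward chains\<close>

definition step :: "(int \<Rightarrow> real) \<Rightarrow> (int \<Rightarrow> real) \<Rightarrow> int \<Rightarrow> real" where
  "step x U n = Fx (x n) (U (n - 1))"

lemma step_pos:
  assumes "\<And>n. 0 < x n" "dK_carrier_sol \<alpha> \<beta> x U"
  shows "0 < step x U n"
  unfolding step_def by (intro Fx_pos assms(1) carrier_solD(1)[OF assms(2)])

text \<open>The forward half of a lattice solution. The carriers are part of the data because a row
  may have several of them.\<close>

definition chain :: "(int \<Rightarrow> real) \<Rightarrow> (nat \<Rightarrow> int \<Rightarrow> real) \<Rightarrow> (nat \<Rightarrow> int \<Rightarrow> real) \<Rightarrow> bool" where
  "chain x X U \<longleftrightarrow> X 0 = x \<and>
     (\<forall>t. dK_carrier_sol \<alpha> \<beta> (X t) (U t) \<and> X (Suc t) = step (X t) (U t))"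

lemma chain_pos:
  assumes "\<And>n. 0 < x n" "chain x X U"
  shows "0 < X t n"
proof (induction t arbitrary: n)
  case 0
  then show ?case using assms by (simp add: chain_def)
next
  case (Suc t)
  then show ?case using assms(2) step_pos[of "X t" "U t"] by (simp add: chain_def)
qed

definition refl_conf :: "(int \<Rightarrow> real) \<Rightarrow> int \<Rightarrow> real" where
  "refl_conf x n = x (- n)"

text \<open>As F is an involution, reversing both space and time gives the same equation again. The
  shifts by 1 arise because the carrier indexed by \<open>n\<close> leads from site \<open>n\<close>
  to \<open>n + 1\<close>, and a row of carriers leads from time \<open>t\<close> to
  \<open>t + 1\<close>.\<close>

lemma lattice_sol_imp_chain:
  assumes "dK_lattice_sol \<alpha> \<beta> x p"
  shows "chain x (\<lambda>t n. fst p n (int t)) (\<lambda>t n. snd p n (int t))"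
    and "chain (refl_conf x) (\<lambda>t n. fst p (- n) (- int t)) (\<lambda>t n. snd p (- n - 1) (- int t - 1))"
proof -
  have pos: "0 < fst p n t" "0 < snd p n t" and init: "fst p n 0 = x n"
    and eq: "Fx (fst p n t) (snd p (n - 1) t) = fst p n (t + 1)"
      "Fu (fst p n t) (snd p (n - 1) t) = snd p n t" for n t
    using assms by (auto simp: dK_lattice_sol_def F_dK_eq)
  show "chain x (\<lambda>t n. fst p n (int t)) (\<lambda>t n. snd p n (int t))"
    unfolding chain_def
    by (auto simp: fun_eq_iff init pos eq step_def add.commute[of 1] intro!: carrier_solI)
  have rev: "Fx (fst p n (t + 1)) (snd p n t) = fst p n t"
     "Fu (fst p n (t + 1)) (snd p n t) = snd p (n - 1) t" for n t
    using F_involution[OF pos(1)[of n t] pos(2)[of "n - 1" t]] by (simp_all add: eq)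
  have rev': "Fx (fst p n t) (snd p n (t - 1)) = fst p n (t - 1)"
     "Fu (fst p n t) (snd p n (t - 1)) = snd p (n - 1) (t - 1)" for n t
    using rev[of n "t - 1"] by simp_all
  show "chain (refl_conf x) (\<lambda>t n. fst p (- n) (- int t)) (\<lambda>t n. snd p (- n - 1) (- int t - 1))"
    unfolding chain_def
    by (auto simp: fun_eq_iff init pos refl_conf_def step_def rev' algebra_simps
        intro!: carrier_solI) (simp add: minus_diff_commute)
qed

lemma chain_imp_lattice_sol:
  assumes pos: "\<And>n. 0 < x n"
    and f: "chain x X U" and b: "chain (refl_conf x) X' U'"
  shows "dK_lattice_sol \<alpha> \<beta> x
     (\<lambda>n t. if 0 \<le> t then X (nat t) n else X' (nat (- t)) (- n),
      \<lambda>n t. if 0 \<le> t then U (nat t) n else U' (nat (- t - 1)) (- n - 1))"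
    (is "dK_lattice_sol _ _ _ (?X, ?U)")
proof -
  have pos': "0 < refl_conf x n" for n by (simp add: pos refl_conf_def)
  note Xpos = chain_pos[OF pos f] chain_pos[OF pos' b]
  have c: "dK_carrier_sol \<alpha> \<beta> (X t) (U t)" "X (Suc t) = step (X t) (U t)"
    "dK_carrier_sol \<alpha> \<beta> (X' t) (U' t)" "X' (Suc t) = step (X' t) (U' t)" for t
    using f b by (auto simp: chain_def)
  have X0: "X' 0 n = X 0 (- n)" "X 0 = x" for n
    using f b by (auto simp: chain_def refl_conf_def)
  have "Fx (?X n t) (?U (n - 1) t) = ?X n (t + 1) \<and> Fu (?X n t) (?U (n - 1) t) = ?U n t" for n t
  proof (cases "0 \<le> t")
    case True
    then show ?thesis
      using c(1)[of "nat t"] c(2)[of "nat t"] carrier_solD(2)[OF c(1)[of "nat t"], of n]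
      by (simp add: nat_add_distrib step_def)
  next
    case False
    \<comment> \<open>Step \<open>s\<close> of the reflected chain, read backwards, leads from time
      \<open>- s - 1\<close> to time \<open>- s\<close>.\<close>
    define s where "s = nat (- t - 1)"
    have t: "t = - int s - 1" using False by (simp add: s_def)
    \<comment> \<open>For \<open>s = 0\<close> the row at time \<open>t + 1 = 0\<close> belongs to
      the forward chain; the two chains agree there by \<open>X0\<close>.\<close>
    have eX: "?X n (t + 1) = X' s (- n)"
      by (cases s) (simp_all add: t X0, simp add: nat_add_distrib)
    have "nat (- t) = Suc s" using t by simp
    then have e: "?X n t = step (X' s) (U' s) (- n)" "?U n t = U' s (- n - 1)" "?U (n - 1) t = U' s (- n)"
      using False c(4)[of s] s_def by simp_all
    have "U' s (- n) = Fu (X' s (- n)) (U' s (- n - 1))"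
      by (rule carrier_solD(2)[OF c(3)])
    then show ?thesis
      unfolding e eX step_def
      using F_involution[OF Xpos(2)[of s "- n"] carrier_solD(1)[OF c(3), of s "- n - 1"]] by simp
  qed
  moreover have "0 < ?X n t" "0 < ?U n t" for n t
    using Xpos carrier_solD(1)[OF c(1)] carrier_solD(1)[OF c(3)] by simp_all
  ultimately show ?thesis
    by (simp add: dK_lattice_sol_def F_dK_eq X0)
qed

definition dynamics :: "(int \<Rightarrow> real) \<Rightarrow> int \<Rightarrow> real" where
  "dynamics x = step x (limit_carrier x)"

lemma lattice_sol_carrier:
  assumes "dK_lattice_sol \<alpha> \<beta> x p"
  shows "dK_carrier_sol \<alpha> \<beta> x (\<lambda>n. snd p n 0)"
  using lattice_sol_imp_chain(1)[OF assms] unfolding chain_def by (metis of_nat_0)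

text \<open>Only the first carrier is prescribed, the later ones are arbitrary choices. Thus
  distinct carriers of \<open>x\<close> lead to distinct chains.\<close>

lemma carrier_imp_chain:
  assumes ex: "\<And>y. (\<And>n. 0 < y n) \<Longrightarrow> \<exists>U. dK_carrier_sol \<alpha> \<beta> y U"
    and pos: "\<And>n. 0 < x n" and U: "dK_carrier_sol \<alpha> \<beta> x U"
  shows "\<exists>X W. chain x X W \<and> W 0 = U"
proof -
  define C where "C y = (SOME U. dK_carrier_sol \<alpha> \<beta> y U)" for y
  have C: "dK_carrier_sol \<alpha> \<beta> y (C y)" if "\<And>n. 0 < y n" for y
    unfolding C_def by (rule someI_ex[OF ex[OF that]])
  define Z where "Z t = ((\<lambda>(y, W). (step y W, C (step y W))) ^^ t) (x, U)" for t :: nat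
  have Z: "Z 0 = (x, U)" "Z (Suc t) = (step (fst (Z t)) (snd (Z t)), C (step (fst (Z t)) (snd (Z t))))" for t
    by (simp_all add: Z_def split_def)
  have inv: "(\<forall>n. 0 < fst (Z t) n) \<and> dK_carrier_sol \<alpha> \<beta> (fst (Z t)) (snd (Z t))" for t
  proof (induction t)
    case (Suc t)
    then have "0 < step (fst (Z t)) (snd (Z t)) n" for n
      using step_pos by blast
    then show ?case by (simp add: Z(2) C)
  qed (use pos U in \<open>simp add: Z(1)\<close>)
  then have "chain x (\<lambda>t. fst (Z t)) (\<lambda>t. snd (Z t))"
    unfolding chain_def using Z by simp
  then show ?thesis using Z(1) by (metis snd_conv)
qed

end

section \<open>The antitone regime \<alpha> \<le> \<beta>\<close>

locale dK_anti = dK +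
  assumes le: "\<alpha> \<le> \<beta>"
begin

lemma Fu_antimono:
  assumes pos: "0 < x" and "0 \<le> u" "u \<le> v"
  shows "Fu x v \<le> Fu x u"
proof -
  have "0 \<le> v" using assms by simp
  note d = den_pos(2)[OF pos \<open>0 \<le> u\<close>] den_pos(2)[OF pos \<open>0 \<le> v\<close>]
  have "Fu x v - Fu x u \<le> 0"
    unfolding Fu_diff[OF pos \<open>0 \<le> v\<close> \<open>0 \<le> u\<close>]
    using d le assms(3) by (intro divide_nonpos_pos mult_nonpos_nonneg) auto
  then show ?thesis by simp
qed

text \<open>Every iterate is at least the start 0, and each application of the antitone recursion
  reverses an inequality while raising both indices by one. The induction runs over all sites at
  once because the recursion moves to the neighbouring site.\<close>

lemma iterates_interlaced:
  assumes pos: "\<And>n. 0 < x n"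
  shows "carrier_from 0 (2 * k) x n \<le> carrier_from 0 (2 * k + 2) x n"
    and "carrier_from 0 (2 * k + 3) x n \<le> carrier_from 0 (2 * k + 1) x n"
    and "carrier_from 0 (2 * k) x n \<le> carrier_from 0 (2 * k + 1) x n"
proof -
  have anti: "carrier_from 0 (Suc j) x m \<le> carrier_from 0 (Suc i) x m"
    if "\<And>m. carrier_from 0 i x m \<le> carrier_from 0 j x m" for i j m
    using Fu_antimono[OF pos carrier_from_nonneg[of x 0]] pos that by simp
  have "\<forall>m. carrier_from 0 (2 * k) x m \<le> carrier_from 0 (2 * k + 2) x m
     \<and> carrier_from 0 (2 * k + 3) x m \<le> carrier_from 0 (2 * k + 1) x m
     \<and> carrier_from 0 (2 * k) x m \<le> carrier_from 0 (2 * k + 1) x m"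
  proof (induction k)
    case 0
    have "0 \<le> carrier_from 0 k x m" for m k
      by (rule carrier_from_nonneg) (use pos in auto)
    then have 1: "carrier_from 0 0 x m \<le> carrier_from 0 k x m" for m k by simp
    show ?case using anti[OF 1[of _ "Suc (Suc 0)"]] 1[of _ 1] 1[of _ 2] by (simp add: numeral_eq_Suc)
  next
    case (Suc k)
    have a: "carrier_from 0 (2 * k + 2) x m \<le> carrier_from 0 (2 * k + 4) x m" for m
      using anti[of "2 * k + 3" "2 * k + 1" m] Suc by (simp add: numeral_eq_Suc)
    have b: "carrier_from 0 (2 * k + 5) x m \<le> carrier_from 0 (2 * k + 3) x m" for m
      using anti[of "2 * k + 2" "2 * k + 4" m] a by (simp add: numeral_eq_Suc)
    have c: "carrier_from 0 (2 * k + 2) x m \<le> carrier_from 0 (2 * k + 1) x m" for m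
      using anti[of "2 * k" "2 * k + 1" m] Suc by (simp add: numeral_eq_Suc)
    have d: "carrier_from 0 (2 * k + 2) x m \<le> carrier_from 0 (2 * k + 3) x m" for m
      using anti[of "2 * k + 2" "2 * k + 1" m] c by (simp add: numeral_eq_Suc)
    show ?case using a b d by (simp add: algebra_simps numeral_eq_Suc)
  qed
  then show "carrier_from 0 (2 * k) x n \<le> carrier_from 0 (2 * k + 2) x n"
    and "carrier_from 0 (2 * k + 3) x n \<le> carrier_from 0 (2 * k + 1) x n"
    and "carrier_from 0 (2 * k) x n \<le> carrier_from 0 (2 * k + 1) x n" by auto
qed

text \<open>The start 0 lies below \<open>U\<close>, and applying the antitone recursion to both
  sides turns lower bounds into upper bounds and back.\<close>

lemma carrier_between_iterates:
  assumes pos: "\<And>n. 0 < x n" and U: "dK_carrier_sol \<alpha> \<beta> x U"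
  shows "carrier_from 0 (2 * k) x n \<le> U n" "U n \<le> carrier_from 0 (2 * k + 1) x n"
proof -
  note U = carrier_solD[OF U]
  have "\<forall>n. carrier_from 0 (2 * k) x n \<le> U n"
  proof (induction k)
    case (Suc k)
    have "U n \<le> carrier_from 0 (2 * k + 1) x n" for n
      using Fu_antimono[OF pos carrier_from_nonneg[of x 0]] pos Suc U(2)[of n] by simp
    then have "carrier_from 0 (Suc (2 * k + 1)) x n \<le> U n" for n
      using Fu_antimono[OF pos less_imp_le[OF U(1)]] U(2)[of n] by (metis carrier_from.simps(2))
    then show ?case by simp
  qed (simp add: U(1) less_imp_le)
  then have low: "carrier_from 0 (2 * k) x n \<le> U n" for n by blast
  show "carrier_from 0 (2 * k) x n \<le> U n" by (rule low)
  have "U n = Fu (x n) (U (n - 1))" by (rule U(2))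
  also have "\<dots> \<le> carrier_from 0 (2 * k + 1) x n"
    using Fu_antimono[OF pos carrier_from_nonneg[of x 0] low] pos by simp
  finally show "U n \<le> carrier_from 0 (2 * k + 1) x n" .
qed

text \<open>Neither limit need be a carrier by itself: the recursion interchanges them, as it maps
  even iterates to odd ones and conversely.\<close>

lemma extremal_carriers:
  assumes pos: "\<And>n. 0 < x n"
  obtains L H where
    "\<And>n. (\<lambda>k. carrier_from 0 (2 * k) x n) \<longlonglongrightarrow> L n"
    "\<And>n. (\<lambda>k. carrier_from 0 (2 * k + 1) x n) \<longlonglongrightarrow> H n"
    "\<And>n. 0 < L n" "\<And>n. 0 < H n" "\<And>n. L n = Fu (x n) (H (n - 1))" "\<And>n. H n = Fu (x n) (L (n - 1))"
proof -
  note m = iterates_interlaced[of x, OF pos]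
  have inc: "incseq (\<lambda>k. carrier_from 0 (2 * k) x n)" for n
    by (rule incseq_SucI) (use m(1) in simp)
  have dec: "decseq (\<lambda>k. carrier_from 0 (2 * k + 1) x n)" for n
    by (rule decseq_SucI) (use m(2) in \<open>simp add: numeral_eq_Suc\<close>)
  have up: "carrier_from 0 (2 * k) x n \<le> carrier_from 0 1 x n" for k n
    using m(3)[of k n] decseqD[OF dec[of n], of 0 k] by simp
  have lo: "0 \<le> carrier_from 0 (2 * k + 1) x n" for k n
    by (rule carrier_from_nonneg) (use pos in auto)
  have "convergent (\<lambda>k. carrier_from 0 (2 * k) x n)" for n
    by (rule incseq_convergent[OF inc[of n], of "carrier_from 0 1 x n"]) (use up convergent_def in blast)+
  then obtain L where L: "\<And>n. (\<lambda>k. carrier_from 0 (2 * k) x n) \<longlonglongrightarrow> L n"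
    by (intro that[of "\<lambda>n. lim (\<lambda>k. carrier_from 0 (2 * k) x n)"]) (simp only: convergent_LIMSEQ_iff)
  have "convergent (\<lambda>k. carrier_from 0 (2 * k + 1) x n)" for n
    by (rule decseq_convergent[OF dec[of n], of 0]) (use lo convergent_def in blast)+
  then obtain H where H: "\<And>n. (\<lambda>k. carrier_from 0 (2 * k + 1) x n) \<longlonglongrightarrow> H n"
    by (intro that[of "\<lambda>n. lim (\<lambda>k. carrier_from 0 (2 * k + 1) x n)"]) (simp only: convergent_LIMSEQ_iff)
  have L0: "0 \<le> L n" for n
    by (rule LIMSEQ_le_const[OF L]) (use carrier_from_nonneg[of x 0] pos in auto)
  have H0: "0 \<le> H n" for n
    by (rule LIMSEQ_le_const[OF H]) (use lo in auto)
  have HL: "H n = Fu (x n) (L (n - 1))" for n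
    by (rule LIMSEQ_unique[OF H]) (use tendsto_Fu[OF L pos L0] in simp)
  have "(\<lambda>k. carrier_from 0 (2 * Suc k) x n) \<longlonglongrightarrow> Fu (x n) (H (n - 1))" for n
    using tendsto_Fu[OF H pos H0, of n "n - 1"] by simp
  then have LH: "L n = Fu (x n) (H (n - 1))" for n
    using LIMSEQ_unique LIMSEQ_Suc[OF L[of n]] by blast
  show ?thesis
  proof (rule that[OF L H])
    show "0 < L n" "0 < H n" for n
      using LH[of n] HL[of n] Fu_pos[OF pos H0] Fu_pos[OF pos L0] by auto
  qed (rule LH HL)+
qed

lemma carrier_exists:
  assumes pos: "\<And>n. 0 < x n"
  shows "\<exists>U. dK_carrier_sol \<alpha> \<beta> x U"
proof -
  obtain L H where *: "\<And>n. 0 < L n" "\<And>n. 0 < H n" "\<And>n. L n = Fu (x n) (H (n - 1))"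
    "\<And>n. H n = Fu (x n) (L (n - 1))"
    using extremal_carriers[of x, OF pos] by metis
  \<comment> \<open>The recursion moves one site and swaps \<open>L\<close> with \<open>H\<close>,
    so alternating them by the parity of the site gives a solution.\<close>
  have "dK_carrier_sol \<alpha> \<beta> x (\<lambda>n. if even n then L n else H n)"
    by (rule carrier_solI) (simp_all add: *(1,2) *(3)[symmetric] *(4)[symmetric])
  then show ?thesis by blast
qed

lemma unique_carrier_iff_convergent:
  assumes pos: "\<And>n. 0 < x n"
  shows "(\<exists>!U. dK_carrier_sol \<alpha> \<beta> x U) \<longleftrightarrow> carrier_convergent x"
proof
  assume ex1: "\<exists>!U. dK_carrier_sol \<alpha> \<beta> x U"
  obtain L H where lim: "\<And>n. (\<lambda>k. carrier_from 0 (2 * k) x n) \<longlonglongrightarrow> L n"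
      "\<And>n. (\<lambda>k. carrier_from 0 (2 * k + 1) x n) \<longlonglongrightarrow> H n" and
    *: "\<And>n. 0 < L n" "\<And>n. 0 < H n" "\<And>n. L n = Fu (x n) (H (n - 1))" "\<And>n. H n = Fu (x n) (L (n - 1))"
    using extremal_carriers[of x, OF pos] by metis
  \<comment> \<open>The alternation comes in two phases; uniqueness identifies them and so closes
    the gap between even and odd iterates.\<close>
  have "dK_carrier_sol \<alpha> \<beta> x (\<lambda>n. if even n then L n else H n)"
    "dK_carrier_sol \<alpha> \<beta> x (\<lambda>n. if even n then H n else L n)"
    by (rule carrier_solI; simp add: *(1,2) *(3)[symmetric] *(4)[symmetric])+
  then have eq: "(\<lambda>n. if even n then L n else H n) = (\<lambda>n. if even n then H n else L n)"
    using ex1 by blast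
  have HL: "H n = L n" for n using fun_cong[OF eq, of n] by (cases "even n") simp_all
  have "(\<lambda>k. carrier_from 0 k x n) \<longlonglongrightarrow> L n" for n
    by (rule limseq_even_odd[OF lim(1) lim(2)[unfolded HL]])
  then show "carrier_convergent x" unfolding carrier_convergent_def convergent_def using pos by blast
next
  assume g: "carrier_convergent x"
  have "U = limit_carrier x" if U: "dK_carrier_sol \<alpha> \<beta> x U" for U
  proof
    fix n
    have lim: "(\<lambda>k. carrier_from 0 (2 * k) x n) \<longlonglongrightarrow> limit_carrier x n"
      "(\<lambda>k. carrier_from 0 (2 * k + 1) x n) \<longlonglongrightarrow> limit_carrier x n"
      using LIMSEQ_subseq_LIMSEQ[OF limit_carrier_LIMSEQ[OF g, of n], of "\<lambda>k. 2 * k"]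
        LIMSEQ_subseq_LIMSEQ[OF limit_carrier_LIMSEQ[OF g, of n], of "\<lambda>k. 2 * k + 1"]
      by (auto simp: strict_mono_def o_def)
    show "U n = limit_carrier x n"
      using LIMSEQ_le_const2[OF lim(1)] LIMSEQ_le_const[OF lim(2)] carrier_between_iterates[OF pos U]
      by (meson antisym)
  qed
  then show "\<exists>!U. dK_carrier_sol \<alpha> \<beta> x U" using limit_carrier_sol[OF g] by blast
qed

text \<open>Every positive configuration has a carrier, so any carrier at time 0 extends to a
  forward chain. Glued to the past of the given solution it is again a lattice solution, and so
  cannot be a new carrier.\<close>

lemma unique_lattice_imp_unique_carrier:
  assumes pos: "\<And>n. 0 < x n" and ex1: "\<exists>!p. dK_lattice_sol \<alpha> \<beta> x p"
  shows "\<exists>!U. dK_carrier_sol \<alpha> \<beta> x U"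
proof -
  obtain p where p: "dK_lattice_sol \<alpha> \<beta> x p" using ex1 by blast
  obtain X' U' where b: "chain (refl_conf x) X' U'"
    using lattice_sol_imp_chain(2)[OF p] by blast
  have "U = (\<lambda>n. snd p n 0)" if U: "dK_carrier_sol \<alpha> \<beta> x U" for U
  proof -
    obtain X W where c: "chain x X W" "W 0 = U"
      using carrier_imp_chain[of x, OF carrier_exists pos U] by blast
    let ?q = "(\<lambda>n t. if 0 \<le> t then X (nat t) n else X' (nat (- t)) (- n),
      \<lambda>n t. if 0 \<le> t then W (nat t) n else U' (nat (- t - 1)) (- n - 1))"
    have "p = ?q" using ex1 p chain_imp_lattice_sol[OF pos c(1) b] by blast
    then show ?thesis using c(2) by simp
  qed
  then show ?thesis using lattice_sol_carrier[OF p] by blast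
qed

lemma dK_defined_iff: "dK_defined \<alpha> \<beta> x \<longleftrightarrow> carrier_convergent x"
  unfolding dK_defined_def using unique_carrier_iff_convergent[of x] unique_lattice_imp_unique_carrier[of x]
  by (auto simp: carrier_convergent_def)

text \<open>Whichever branch \<open>dK_U\<close> takes, its value is a carrier, and on the domain
  there is only one.\<close>

lemma dK_T_eq: "dK_T \<alpha> \<beta> x = (if carrier_convergent x then dynamics x else x)"
proof (cases "carrier_convergent x")
  case True
  then have pos: "0 < x n" for n by (simp add: carrier_convergent_def)
  have ex1: "\<exists>!U. dK_carrier_sol \<alpha> \<beta> x U" using unique_carrier_iff_convergent pos True by blast
  have "dK_carrier_sol \<alpha> \<beta> x (dK_U \<alpha> \<beta> x)"
  proof (cases "\<exists>!p. dK_lattice_sol \<alpha> \<beta> x p")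
    case True
    then show ?thesis using lattice_sol_carrier[OF theI'[OF True]] by (simp add: dK_U_def)
  next
    case False
    then show ?thesis using theI'[OF ex1] by (simp add: dK_U_def)
  qed
  then have "dK_U \<alpha> \<beta> x = limit_carrier x" using ex1 limit_carrier_sol[OF True] by blast
  then show ?thesis
    using True by (simp add: dK_T_def dK_defined_iff dynamics_def step_def F_dK_eq fun_eq_iff)
qed (simp add: dK_T_def dK_defined_iff)

end

section \<open>The affine regime \<beta> = 0 < \<alpha>\<close>

locale dK_affine = dK +
  assumes \<alpha>_pos: "0 < \<alpha>" and \<beta>_zero: "\<beta> = 0"
begin

lemma Fu_affine: "Fu x u = x + \<alpha> * x\<^sup>2 * u"
  unfolding Fu_def by (simp add: \<beta>_zero power2_eq_square algebra_simps)

lemma Fx_affine: "Fx x u = u / (1 + \<alpha> * x * u)"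
  unfolding Fx_def by (simp add: \<beta>_zero)

text \<open>The recursion is increasing and 0 lies below \<open>U\<close>, so the iterates increase
  and stay below \<open>U\<close>; their limit is the minimal carrier.\<close>

lemma carrier_imp_carrier_convergent:
  assumes pos: "\<And>n. 0 < x n" and U: "dK_carrier_sol \<alpha> \<beta> x U"
  shows "carrier_convergent x" "limit_carrier x n \<le> U n"
proof -
  note U = carrier_solD[OF U]
  have mono: "Fu (x m) u \<le> Fu (x m) v" if "u \<le> v" for m u v
    using that \<alpha>_pos by (simp add: Fu_affine mult_left_mono)
  have le: "carrier_from 0 k x n \<le> U n" for k n
  proof (induction k arbitrary: n)
    case (Suc k)
    then show ?case using mono U(2)[of n] by simp
  qed (simp add: U(1) less_imp_le)
  have "carrier_from 0 k x n \<le> carrier_from 0 (Suc k) x n" for k n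
  proof (induction k arbitrary: n)
    case 0
    then show ?case using Fu_pos[OF pos, of 0] by (simp add: less_imp_le)
  next
    case (Suc k)
    show ?case using mono[OF Suc[of "n - 1"]] by (simp only: carrier_from.simps)
  qed
  then have "incseq (\<lambda>k. carrier_from 0 k x n)" for n by (rule incseq_SucI)
  then have "convergent (\<lambda>k. carrier_from 0 k x n)" for n
    by (rule incseq_convergent[of _ "U n"]) (use le convergent_def in blast)+
  then show g: "carrier_convergent x" by (simp add: carrier_convergent_def pos)
  show "limit_carrier x n \<le> U n" by (rule LIMSEQ_le_const2[OF limit_carrier_LIMSEQ[OF g]]) (use le in auto)
qed

lemma increments_tendsto_0:
  fixes Q :: "int \<Rightarrow> real"
  assumes "\<And>n. 0 < Q n" "\<And>n. Q (n - 1) \<le> Q n"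
  shows "(\<lambda>k. Q (- int k) - Q (- int k - 1)) \<longlonglongrightarrow> 0"
proof -
  have e: "- int (Suc k) = - int k - 1" for k by simp
  have "decseq (\<lambda>k. Q (- int k))"
    by (rule decseq_SucI) (unfold e, rule assms)
  then obtain l where l: "(\<lambda>k. Q (- int k)) \<longlonglongrightarrow> l"
    by (rule decseq_convergent[of _ 0]) (use assms(1) less_imp_le in blast)
  show ?thesis using tendsto_diff[OF l LIMSEQ_Suc[OF l], unfolded e] by (simp only: diff_self)
qed

text \<open>A non-minimal carrier \<open>U\<close> exceeds the minimal one by a positive solution \<open>D\<close> of the
  homogeneous recursion. With \<open>E = D / U\<^sup>2\<close>, both \<open>limit_carrier x / D\<close> and \<open>W / E\<close> would be positive and
  increasing, so their increments tend to 0 at minus infinity; but the increments have product at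
  least \<open>1 / \<alpha>\<close>.\<close>
lemma carrier_of_step_imp_minimal:
  assumes pos: "\<And>n. 0 < x n" and U: "dK_carrier_sol \<alpha> \<beta> x U"
    and W: "dK_carrier_sol \<alpha> \<beta> (step x U) W"
  shows "U = limit_carrier x"
proof (rule ccontr)
  assume "U \<noteq> limit_carrier x"
  then obtain i where i: "U i \<noteq> limit_carrier x i" by blast
  define D where "D n = U n - limit_carrier x n" for n
  note g = carrier_imp_carrier_convergent(1)[OF pos U] and VU = carrier_imp_carrier_convergent(2)[OF pos U]
  note v = carrier_solD[OF limit_carrier_sol[OF g]] and u = carrier_solD[OF U] and w = carrier_solD[OF W]
  have Drec: "D n = \<alpha> * (x n)\<^sup>2 * D (n - 1)" for n
    using u(2)[of n] v(2)[of n] by (simp add: D_def Fu_affine algebra_simps)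
  have D0: "0 \<le> D n" for n using VU by (simp add: D_def)
  have Dpos: "0 < D n" for n
  proof -
    have iff: "D n = 0 \<longleftrightarrow> D (n - 1) = 0" for n
      using Drec[of n] \<alpha>_pos pos[of n] by simp
    have "D n \<noteq> 0"
    proof (induction n rule: int_induct[where k=i])
      case base
      then show ?case using i by (simp add: D_def)
    next
      case (step1 m)
      then show ?case using iff[of "m + 1"] by simp
    next
      case (step2 m)
      then show ?case using iff[of m] by simp
    qed
    then show ?thesis using D0[of n] by simp
  qed
  have DU: "D n \<le> U n" for n using v(1)[of n] by (simp add: D_def)
  define y where "y = step x U"
  \<comment> \<open>This is the conservation of the product of the two components under F.\<close>
  have yU: "y n * U n = x n * U (n - 1)" for n
  proof -
    have "0 < 1 + \<alpha> * x n * U (n - 1)" using den_pos(1)[OF pos less_imp_le[OF u(1)]] .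
    then show ?thesis
      unfolding y_def step_def Fx_affine u(2)[of n] Fu_affine
      by (simp add: divide_simps power2_eq_square) (simp add: algebra_simps)
  qed
  have ypos: "0 < y n" for n unfolding y_def by (rule step_pos[OF pos U])
  \<comment> \<open>As \<open>y n = x n * U (n - 1) / U n\<close>, division by
    \<open>(U n)\<^sup>2\<close> turns the homogeneous recursion for \<open>x\<close> into the one
    for \<open>y\<close>.\<close>
  define E where "E n = D n / (U n)\<^sup>2" for n
  have Epos: "0 < E n" for n unfolding E_def using Dpos[of n] u(1)[of n] by simp
  have Erec: "E n = \<alpha> * (y n)\<^sup>2 * E (n - 1)" for n
  proof -
    have "y n = x n * U (n - 1) / U n"
      using yU[of n] u(1)[of n] by (simp add: field_simps)
    then have "(y n)\<^sup>2 = (x n * U (n - 1) / U n)\<^sup>2" by simp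
    then show ?thesis
      unfolding E_def Drec[of n] using u(1)[of n] u(1)[of "n - 1"]
      by (simp add: divide_simps power_mult_distrib power_divide)
  qed
  \<comment> \<open>Variation of constants: divided by a homogeneous solution, an affine recursion
    becomes a sum with explicit increments.\<close>
  define R where "R n = limit_carrier x n / D n" for n
  define Q where "Q n = W n / E n" for n
  have R: "R n - R (n - 1) = x n / D n" for n
  proof -
    have "limit_carrier x n / D n = x n / D n + \<alpha> * (x n)\<^sup>2 * limit_carrier x (n - 1) / (\<alpha> * (x n)\<^sup>2 * D (n - 1))"
      unfolding Drec[symmetric] v(2)[of n] Fu_affine by (simp add: add_divide_distrib)
    also have "\<alpha> * (x n)\<^sup>2 * limit_carrier x (n - 1) / (\<alpha> * (x n)\<^sup>2 * D (n - 1)) = limit_carrier x (n - 1) / D (n - 1)"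
      using \<alpha>_pos pos[of n] by simp
    finally show ?thesis by (simp add: R_def)
  qed
  have Q: "Q n - Q (n - 1) = y n / E n" for n
  proof -
    have "W n / E n = y n / E n + \<alpha> * (y n)\<^sup>2 * W (n - 1) / (\<alpha> * (y n)\<^sup>2 * E (n - 1))"
      unfolding Erec[symmetric] w(2)[of n, folded y_def] Fu_affine by (simp add: add_divide_distrib)
    also have "\<alpha> * (y n)\<^sup>2 * W (n - 1) / (\<alpha> * (y n)\<^sup>2 * E (n - 1)) = W (n - 1) / E (n - 1)"
      using \<alpha>_pos ypos[of n] by simp
    finally show ?thesis by (simp add: Q_def)
  qed
  \<comment> \<open>The product equals
    \<open>(x n)\<^sup>2 * U (n - 1) * U n / (D n)\<^sup>2\<close>. Replacing each \<open>U\<close>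
    by the smaller \<open>D\<close> leaves \<open>(x n)\<^sup>2 * D (n - 1) / D n\<close>, which is
    \<open>1 / \<alpha>\<close> by \<open>Drec\<close>.\<close>
  have prod: "1 / \<alpha> \<le> (R n - R (n - 1)) * (Q n - Q (n - 1))" for n
  proof -
    have "D (n - 1) * D n \<le> U (n - 1) * U n"
      by (intro mult_mono DU D0 less_imp_le[OF u(1)])
    then have "x n * (D (n - 1) * D n) * x n / (D n * D n) \<le> x n * (U (n - 1) * U n) * x n / (D n * D n)"
      using pos[of n] Dpos[of n] by (intro divide_right_mono mult_right_mono mult_left_mono) auto
    moreover have "x n * (D (n - 1) * D n) * x n / (D n * D n) = 1 / \<alpha>"
      using Dpos[of n] Dpos[of "n - 1"] pos[of n] \<alpha>_pos Drec[of n]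
      by (simp add: divide_simps power2_eq_square)
    moreover have "(R n - R (n - 1)) * (Q n - Q (n - 1)) = x n * (U (n - 1) * U n) * x n / (D n * D n)"
      unfolding R Q E_def using u(1)[of n] Dpos[of n] yU[of n]
      by (simp add: power2_eq_square divide_simps)
    ultimately show ?thesis by simp
  qed
  have "0 < R n" "0 < Q n" for n
    using v(1)[of n] Dpos[of n] w(1)[of n] Epos[of n] by (simp_all add: R_def Q_def)
  moreover have "R (n - 1) \<le> R n" "Q (n - 1) \<le> Q n" for n
    using R[of n] Q[of n] pos[of n] ypos[of n] Dpos[of n] Epos[of n]
      divide_pos_pos[of "x n" "D n"] divide_pos_pos[of "y n" "E n"] by linarith+
  ultimately have "(\<lambda>k. (R (- int k) - R (- int k - 1)) * (Q (- int k) - Q (- int k - 1))) \<longlonglongrightarrow> 0 * 0"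
    by (intro tendsto_mult increments_tendsto_0)
  then have "1 / \<alpha> \<le> 0"
    using LIMSEQ_le_const[of _ "0::real" "1 / \<alpha>"] prod by auto
  then show False using \<alpha>_pos by simp
qed

text \<open>Each row of a chain is followed by a row that has a carrier, which forces its own
  carrier to be minimal. A chain has therefore no freedom beyond its first row.\<close>

lemma chain_eq:
  assumes pos: "\<And>n. 0 < x n" and c: "chain x X U"
  shows "X t = (dynamics ^^ t) x" "U t = limit_carrier ((dynamics ^^ t) x)" "carrier_convergent ((dynamics ^^ t) x)"
proof -
  have c': "dK_carrier_sol \<alpha> \<beta> (X t) (U t)" "X (Suc t) = step (X t) (U t)" "X 0 = x" for t
    using c by (auto simp: chain_def)
  have U: "U t = limit_carrier (X t)" for t
    using carrier_of_step_imp_minimal[OF chain_pos[OF pos c] c'(1)] c'(1)[of "Suc t"] by (simp add: c'(2))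
  show X: "X t = (dynamics ^^ t) x" for t
    by (induction t) (simp_all add: c' U dynamics_def)
  show "U t = limit_carrier ((dynamics ^^ t) x)" using U X by simp
  show "carrier_convergent ((dynamics ^^ t) x)"
    using carrier_imp_carrier_convergent(1)[OF chain_pos[OF pos c] c'(1)] X by simp
qed

lemma chain_exists:
  assumes "\<And>t. carrier_convergent ((dynamics ^^ t) x)"
  shows "chain x (\<lambda>t. (dynamics ^^ t) x) (\<lambda>t. limit_carrier ((dynamics ^^ t) x))"
  using limit_carrier_sol[OF assms] by (simp add: chain_def dynamics_def)

definition lattice_solvable :: "(int \<Rightarrow> real) \<Rightarrow> bool" where
  "lattice_solvable x \<longleftrightarrow> (\<forall>t. carrier_convergent ((dynamics ^^ t) x)) \<and> (\<forall>t. carrier_convergent ((dynamics ^^ t) (refl_conf x)))"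

lemma lattice_solvable_pos: "lattice_solvable x \<Longrightarrow> 0 < x n"
  unfolding lattice_solvable_def carrier_convergent_def by (metis funpow_0)

lemma lattice_sol_eq:
  assumes pos: "\<And>n. 0 < x n" and p: "dK_lattice_sol \<alpha> \<beta> x p"
  shows "lattice_solvable x" "p = (\<lambda>n t. if 0 \<le> t then (dynamics ^^ nat t) x n else (dynamics ^^ nat (- t)) (refl_conf x) (- n),
      \<lambda>n t. if 0 \<le> t then limit_carrier ((dynamics ^^ nat t) x) n else limit_carrier ((dynamics ^^ nat (- t - 1)) (refl_conf x)) (- n - 1))"
proof -
  have pos': "0 < refl_conf x n" for n by (simp add: pos refl_conf_def)
  note f = chain_eq[OF pos lattice_sol_imp_chain(1)[OF p]]
    and b = chain_eq[OF pos' lattice_sol_imp_chain(2)[OF p]]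
  show "lattice_solvable x" using f(3) b(3) by (simp add: lattice_solvable_def)
  show "p = (\<lambda>n t. if 0 \<le> t then (dynamics ^^ nat t) x n else (dynamics ^^ nat (- t)) (refl_conf x) (- n),
      \<lambda>n t. if 0 \<le> t then limit_carrier ((dynamics ^^ nat t) x) n else limit_carrier ((dynamics ^^ nat (- t - 1)) (refl_conf x)) (- n - 1))"
    by (rule prod_eqI)
      (simp add: fun_eq_iff f(1)[symmetric] b(1)[symmetric],
       simp add: fun_eq_iff f(2)[symmetric] b(2)[symmetric])
qed

lemma unique_lattice_iff:
  assumes pos: "\<And>n. 0 < x n"
  shows "(\<exists>!p. dK_lattice_sol \<alpha> \<beta> x p) \<longleftrightarrow> lattice_solvable x"
proof
  assume "\<exists>!p. dK_lattice_sol \<alpha> \<beta> x p"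
  then show "lattice_solvable x" using lattice_sol_eq(1)[of x, OF pos] by blast
next
  assume "lattice_solvable x"
  then obtain p where p: "dK_lattice_sol \<alpha> \<beta> x p"
    using chain_imp_lattice_sol[OF pos chain_exists[of x] chain_exists[of "refl_conf x"]]
    by (auto simp: lattice_solvable_def)
  then show "\<exists>!p. dK_lattice_sol \<alpha> \<beta> x p"
  proof (rule ex1I)
    show "q = p" if q: "dK_lattice_sol \<alpha> \<beta> x q" for q
      by (rule trans[OF lattice_sol_eq(2)[of x, OF pos q] lattice_sol_eq(2)[of x, OF pos p, symmetric]])
  qed
qed

text \<open>Adding a positive solution of the homogeneous recursion to a carrier gives another
  carrier.\<close>

lemma not_unique_carrier:
  assumes pos: "\<And>n. 0 < x n"
  shows "\<not> (\<exists>!U. dK_carrier_sol \<alpha> \<beta> x U)"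
proof
  assume ex1: "\<exists>!U. dK_carrier_sol \<alpha> \<beta> x U"
  then obtain U where U: "dK_carrier_sol \<alpha> \<beta> x U" by blast
  note u = carrier_solD[OF U]
  define q where "q n = \<alpha> * (x n)\<^sup>2" for n
  have q: "0 < q n" for n using \<alpha>_pos pos[of n] by (simp add: q_def)
  \<comment> \<open>The homogeneous solution with \<open>h (- 1) = 1\<close>: products of the
    factors to the right, reciprocals of products to the left.\<close>
  define h where "h n = (if 0 \<le> n then \<Prod>j\<in>{0..n}. q j else 1 / (\<Prod>j\<in>{n<..<0}. q j))" for n
  have hpos: "0 < h n" for n by (simp add: h_def q prod_pos)
  have hrec: "h n = q n * h (n - 1)" for n
  proof (cases "0 \<le> n")
    case True
    then have "{0..n} = insert n {0..n - 1}" by auto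
    moreover have "{n - 1<..<0} = {}" using True by auto
    ultimately show ?thesis using True by (auto simp: h_def)
  next
    case False
    then have "{n - 1<..<0} = insert n {n<..<0}" by auto
    then show ?thesis using False q[of n] by (simp add: h_def)
  qed
  have "dK_carrier_sol \<alpha> \<beta> x (\<lambda>n. U n + h n)"
  proof (rule carrier_solI)
    show "0 < U n + h n" for n by (rule add_pos_pos[OF u(1) hpos])
    show "U n + h n = Fu (x n) (U (n - 1) + h (n - 1))" for n
      unfolding u(2)[of n] hrec[of n] Fu_affine q_def by (simp add: algebra_simps)
  qed
  with ex1 U have "(\<lambda>n. U n + h n) = U" by blast
  then have "U 0 + h 0 = U 0" by (rule fun_cong)
  then show False using hpos[of 0] by simp
qed

lemma dK_defined_iff: "dK_defined \<alpha> \<beta> x \<longleftrightarrow> lattice_solvable x"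
  unfolding dK_defined_def using unique_lattice_iff[of x] not_unique_carrier[of x] lattice_solvable_pos by auto

lemma dK_T_eq: "dK_T \<alpha> \<beta> x = (if lattice_solvable x then dynamics x else x)"
proof (cases "lattice_solvable x")
  case True
  then have ex1: "\<exists>!p. dK_lattice_sol \<alpha> \<beta> x p" using unique_lattice_iff lattice_solvable_pos by blast
  then have "dK_U \<alpha> \<beta> x = limit_carrier x"
    using lattice_sol_eq(2)[of x, OF lattice_solvable_pos[OF True] theI'[OF ex1]] by (simp add: dK_U_def)
  then show ?thesis
    using True by (simp add: dK_T_def dK_defined_iff dynamics_def step_def F_dK_eq fun_eq_iff)
qed (simp add: dK_T_def dK_defined_iff)

end

section \<open>Burke property of product measures\<close>

locale iid_sequence = real_distribution \<mu> for \<mu> :: "real measure"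
begin

abbreviation P :: "(int \<Rightarrow> real) measure" where
  "P \<equiv> Pi\<^sub>M UNIV (\<lambda>_. \<mu>)"

sublocale P: product_prob_space "\<lambda>_::int. \<mu>" UNIV ..

lemma space_P [simp]: "space P = UNIV"
  by (simp add: space_PiM PiE_UNIV_domain)

lemma emeasure_P [simp]: "emeasure P UNIV = 1"
  using P.P.emeasure_space_1 by simp

lemma measurable_coord: "(\<lambda>x. x n) \<in> borel_measurable P"
  using measurable_component_singleton[of n UNIV "\<lambda>_. \<mu>"] by simp

lemma measurable_P_I:
  "(\<And>n. (\<lambda>x. f x n) \<in> borel_measurable M) \<Longrightarrow> f \<in> measurable M P"
  by (rule measurable_PiM_single') (simp_all add: PiE_UNIV_domain)

lemma measurable_fun_upd_P:
  "(\<lambda>z. (snd z)(i := fst z)) \<in> measurable (\<mu> \<Otimes>\<^sub>M P) P"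
  by (rule measurable_P_I) (simp add: fun_upd_def)

text \<open>Replacing one coordinate by an independent copy does not change the law; independence
  thereby becomes an iterated integral.\<close>

lemma nn_integral_resample:
  assumes [measurable]: "f \<in> borel_measurable P"
  shows "(\<integral>\<^sup>+x. f x \<partial>P) = (\<integral>\<^sup>+s. \<integral>\<^sup>+x. f (x(i := s)) \<partial>P \<partial>\<mu>)"
proof -
  note [measurable] = measurable_fun_upd_P
  have "(\<integral>\<^sup>+x. f x \<partial>P) = (\<integral>\<^sup>+x. f x \<partial>distr (\<mu> \<Otimes>\<^sub>M P) P (\<lambda>z. (snd z)(i := fst z)))"
    using distr_pair_PiM_eq_PiM[of UNIV "\<lambda>_. \<mu>" i, OF prob_space_axioms prob_space_axioms]
    by (simp add: split_def)
  also have "\<dots> = (\<integral>\<^sup>+z. f ((snd z)(i := fst z)) \<partial>(\<mu> \<Otimes>\<^sub>M P))"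
    by (rule nn_integral_distr) measurable
  also have "\<dots> = (\<integral>\<^sup>+s. \<integral>\<^sup>+x. f (x(i := s)) \<partial>P \<partial>\<mu>)"
    by (subst P.P.nn_integral_fst[symmetric]) (simp_all, measurable)
  finally show ?thesis .
qed

text \<open>Invariance under overwriting expresses that \<open>\<Phi>\<close> ignores coordinate
  \<open>i\<close>, so resampling this coordinate separates the two arguments of
  \<open>f\<close>.\<close>

lemma nn_integral_indep_coord:
  assumes [measurable]: "\<Phi> \<in> measurable P N" "(\<lambda>z. f (fst z) (snd z)) \<in> borel_measurable (borel \<Otimes>\<^sub>M N)"
    and \<Phi>: "\<And>x s. \<Phi> (x(i := s)) = \<Phi> x"
  shows "(\<integral>\<^sup>+x. f (x i) (\<Phi> x) \<partial>P) = (\<integral>\<^sup>+s. \<integral>\<^sup>+x. f s (\<Phi> x) \<partial>P \<partial>\<mu>)"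
proof -
  have "(\<lambda>x. f (x i) (\<Phi> x)) \<in> borel_measurable P"
    using measurable_compose[OF measurable_Pair[OF measurable_coord[of i] assms(1)] assms(2)] by simp
  from nn_integral_resample[OF this, of i] show ?thesis by (simp add: \<Phi>)
qed

lemma distr_refl: "distr P P (\<lambda>x n. x (- n)) = P"
  using distr_PiM_reindex[of UNIV "\<lambda>_. \<mu>" "uminus :: int \<Rightarrow> int" UNIV] prob_space_axioms
  by (simp add: restrict_def inj_on_def)

end

section \<open>Measurability in the configuration\<close>

context dK
begin

lemma measurable_Fx [measurable (raw)]:
  assumes [measurable]: "f \<in> borel_measurable M" "g \<in> borel_measurable M"
  shows "(\<lambda>x. Fx (f x) (g x)) \<in> borel_measurable M"
  unfolding Fx_def by measurable

lemma measurable_Fu [measurable (raw)]: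
  assumes [measurable]: "f \<in> borel_measurable M" "g \<in> borel_measurable M"
  shows "(\<lambda>x. Fu (f x) (g x)) \<in> borel_measurable M"
  unfolding Fu_def by measurable

lemma measurable_carrier_from [measurable (raw)]:
  assumes [measurable]: "f \<in> borel_measurable M" "\<And>n. (\<lambda>z. g z n) \<in> borel_measurable M"
  shows "(\<lambda>z. carrier_from (f z) k (g z) n) \<in> borel_measurable M"
  by (induction k arbitrary: n) simp_all

lemma measurable_limit_carrier [measurable (raw)]:
  assumes [measurable]: "\<And>n. (\<lambda>z. g z n) \<in> borel_measurable M"
  shows "(\<lambda>z. limit_carrier (g z) n) \<in> borel_measurable M"
  unfolding limit_carrier_def by measurable

text \<open>The Cauchy criterion expresses convergence by countably many conditions, without
  mentioning the limit.\<close>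

lemma measurable_carrier_convergent:
  assumes [measurable]: "\<And>n. (\<lambda>z. g z n) \<in> borel_measurable M"
  shows "Measurable.pred M (\<lambda>z. carrier_convergent (g z))"
  unfolding carrier_convergent_def Cauchy_convergent_iff[symmetric] pred_def by measurable

lemma measurable_dynamics [measurable (raw)]:
  assumes [measurable]: "\<And>n. (\<lambda>z. g z n) \<in> borel_measurable M"
  shows "(\<lambda>z. dynamics (g z) n) \<in> borel_measurable M"
  unfolding dynamics_def step_def by measurable

lemma dynamics_cong: "(\<And>m. m \<le> n \<Longrightarrow> x m = y m) \<Longrightarrow> dynamics x n = dynamics y n"
  using limit_carrier_cong[of "n - 1" x y] by (simp add: dynamics_def step_def)

end

section \<open>Stationary pairs of laws and Burke's argument\<close>

locale stationary_dK = dK \<alpha> \<beta> + \<mu>: iid_sequence \<mu> + \<nu>: real_distribution \<nu>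
  for \<alpha> \<beta> :: real and \<mu> \<nu> :: "real measure" +
  assumes \<nu>_pos: "AE u in \<nu>. 0 < u"
    and F_preserves: "\<And>f. f \<in> borel_measurable (borel \<Otimes>\<^sub>M borel) \<Longrightarrow>
      (\<integral>\<^sup>+x. \<integral>\<^sup>+u. f (Fx x u, Fu x u) \<partial>\<nu> \<partial>\<mu>) = (\<integral>\<^sup>+x. \<integral>\<^sup>+u. f (x, u) \<partial>\<nu> \<partial>\<mu>)"
    and AE_carrier_convergent: "AE x in Pi\<^sub>M UNIV (\<lambda>_::int. \<mu>). carrier_convergent x"
    and AE_conv: "AE x in Pi\<^sub>M UNIV (\<lambda>_::int. \<mu>).
      \<forall>n u. 0 < u \<longrightarrow> (\<lambda>k. carrier_from u k x n) \<longlonglongrightarrow> limit_carrier x n"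
begin

abbreviation P :: "(int \<Rightarrow> real) measure" where
  "P \<equiv> Pi\<^sub>M UNIV (\<lambda>_. \<mu>)"

sublocale \<nu>P: pair_prob_space \<nu> P ..
sublocale \<nu>\<mu>: pair_prob_space \<nu> \<mu> ..

lemma nn_integral_carrier_from:
  assumes [measurable]: "f \<in> borel_measurable borel"
  shows "(\<integral>\<^sup>+u. \<integral>\<^sup>+x. f (carrier_from u k x n) \<partial>P \<partial>\<nu>) = (\<integral>\<^sup>+u. f u \<partial>\<nu>)"
  using assms
proof (induction k arbitrary: n f)
  case 0
  then show ?case by simp
next
  case (Suc k)
  note [measurable] = \<open>f \<in> borel_measurable borel\<close>
  have "(\<integral>\<^sup>+x. f (carrier_from u (Suc k) x n) \<partial>P)
      = (\<integral>\<^sup>+s. \<integral>\<^sup>+x. f (Fu s (carrier_from u k x (n - 1))) \<partial>P \<partial>\<mu>)" for u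
    unfolding carrier_from.simps
  proof (rule \<mu>.nn_integral_indep_coord[where N=borel and f="\<lambda>s v. f (Fu s v)"])
    show "carrier_from u k (x(n := s)) (n - 1) = carrier_from u k x (n - 1)" for x s
      by (rule carrier_from_cong) simp
  qed measurable
  then have "(\<integral>\<^sup>+u. \<integral>\<^sup>+x. f (carrier_from u (Suc k) x n) \<partial>P \<partial>\<nu>)
      = (\<integral>\<^sup>+u. \<integral>\<^sup>+s. \<integral>\<^sup>+x. f (Fu s (carrier_from u k x (n - 1))) \<partial>P \<partial>\<mu> \<partial>\<nu>)"
    by simp
  also have "\<dots> = (\<integral>\<^sup>+s. \<integral>\<^sup>+u. \<integral>\<^sup>+x. f (Fu s (carrier_from u k x (n - 1))) \<partial>P \<partial>\<nu> \<partial>\<mu>)"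
    by (rule \<nu>\<mu>.Fubini'[symmetric]) measurable
  also have "\<dots> = (\<integral>\<^sup>+s. \<integral>\<^sup>+v. f (Fu s v) \<partial>\<nu> \<partial>\<mu>)"
    by (intro nn_integral_cong Suc.IH) measurable
  also have "\<dots> = (\<integral>\<^sup>+s. \<integral>\<^sup>+v. f v \<partial>\<nu> \<partial>\<mu>)"
    using F_preserves[of "\<lambda>z. f (snd z)"] by simp
  also have "\<dots> = (\<integral>\<^sup>+u. f u \<partial>\<nu>)"
    using \<mu>.emeasure_space_1 by simp
  finally show ?case .
qed

lemma distr_carrier_from:
  "distr (\<nu> \<Otimes>\<^sub>M P) borel (\<lambda>z. carrier_from (fst z) k (snd z) n) = \<nu>"
proof (rule measure_eqI)
  fix A assume "A \<in> sets (distr (\<nu> \<Otimes>\<^sub>M P) borel (\<lambda>z. carrier_from (fst z) k (snd z) n))"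
  then have [measurable]: "A \<in> sets borel" by simp
  have "emeasure (distr (\<nu> \<Otimes>\<^sub>M P) borel (\<lambda>z. carrier_from (fst z) k (snd z) n)) A
    = (\<integral>\<^sup>+v. indicator A v \<partial>distr (\<nu> \<Otimes>\<^sub>M P) borel (\<lambda>z. carrier_from (fst z) k (snd z) n))"
    by simp
  also have "\<dots> = (\<integral>\<^sup>+z. indicator A (carrier_from (fst z) k (snd z) n) \<partial>(\<nu> \<Otimes>\<^sub>M P))"
    by (rule nn_integral_distr) measurable
  also have "\<dots> = (\<integral>\<^sup>+u. \<integral>\<^sup>+x. indicator A (carrier_from u k x n) \<partial>P \<partial>\<nu>)"
    by (subst \<mu>.P.P.nn_integral_fst[symmetric]) (simp_all, measurable)
  also have "\<dots> = emeasure \<nu> A"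
    by (subst nn_integral_carrier_from) simp_all
  finally show "emeasure (distr (\<nu> \<Otimes>\<^sub>M P) borel (\<lambda>z. carrier_from (fst z) k (snd z) n)) A = emeasure \<nu> A" .
qed simp

text \<open>On \<open>\<nu> \<Otimes>\<^sub>M P\<close> the first factor supplies a random start.
  All iterates then have law \<nu> and converge almost surely to the limit carrier, so dominated
  convergence identifies the characteristic functions. Since the start is random,
  \<open>AE_conv\<close> allows all positive starts on one common set of full measure.\<close>

lemma distr_limit_carrier: "distr P borel (\<lambda>x. limit_carrier x n) = \<nu>"
proof (rule Levy_uniqueness)
  show "real_distribution (distr P borel (\<lambda>x. limit_carrier x n))"
    by (rule \<mu>.P.P.real_distribution_distr) measurable
  show "real_distribution \<nu>" ..
  have snd: "distr (\<nu> \<Otimes>\<^sub>M P) P snd = P"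
    by (rule measure_eqI)
      (use \<nu>.emeasure_space_1 in \<open>simp_all add: emeasure_distr \<mu>.P.P.emeasure_pair_measure_Times
         space_pair_measure snd_vimage_eq_Times Times_Int_Times\<close>)
  have "AE z in \<nu> \<Otimes>\<^sub>M P. 0 < fst z"
  proof -
    have univ: "UNIV \<in> sets P" using sets.top[of P] by simp
    have d: "distr (\<nu> \<Otimes>\<^sub>M P) \<nu> fst = \<nu>"
      by (rule measure_eqI)
        (simp_all add: univ emeasure_distr \<mu>.P.P.emeasure_pair_measure_Times
           space_pair_measure fst_vimage_eq_Times Times_Int_Times)
    show ?thesis
      by (rule AE_distrD[of fst "\<nu> \<Otimes>\<^sub>M P" \<nu>]) (simp, unfold d, rule \<nu>_pos)
  qed
  moreover have "AE z in \<nu> \<Otimes>\<^sub>M P. \<forall>n u. 0 < u \<longrightarrow> (\<lambda>k. carrier_from u k (snd z) n) \<longlonglongrightarrow> limit_carrier (snd z) n"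
    by (rule AE_distrD[of snd "\<nu> \<Otimes>\<^sub>M P" P]) (simp, unfold snd, rule AE_conv)
  ultimately have lim: "AE z in \<nu> \<Otimes>\<^sub>M P. (\<lambda>k. carrier_from (fst z) k (snd z) n) \<longlonglongrightarrow> limit_carrier (snd z) n"
    by eventually_elim blast
  show "char (distr P borel (\<lambda>x. limit_carrier x n)) = char \<nu>"
  proof
    fix t
    have "(\<lambda>k. \<integral>z. iexp (t * carrier_from (fst z) k (snd z) n) \<partial>(\<nu> \<Otimes>\<^sub>M P))
        \<longlonglongrightarrow> (\<integral>z. iexp (t * limit_carrier (snd z) n) \<partial>(\<nu> \<Otimes>\<^sub>M P))"
    proof (rule integral_dominated_convergence[where w="\<lambda>_. 1"])
      show "AE z in \<nu> \<Otimes>\<^sub>M P. (\<lambda>k. iexp (t * carrier_from (fst z) k (snd z) n)) \<longlonglongrightarrow> iexp (t * limit_carrier (snd z) n)"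
        using lim by eventually_elim (intro tendsto_intros)
    qed (simp_all, measurable)
    moreover have "(\<integral>z. iexp (t * carrier_from (fst z) k (snd z) n) \<partial>(\<nu> \<Otimes>\<^sub>M P)) = char \<nu> t" for k
    proof -
      have "char \<nu> t = char (distr (\<nu> \<Otimes>\<^sub>M P) borel (\<lambda>z. carrier_from (fst z) k (snd z) n)) t"
        by (simp add: distr_carrier_from)
      then show ?thesis by (simp add: char_def integral_distr)
    qed
    moreover have "(\<integral>z. iexp (t * limit_carrier (snd z) n) \<partial>(\<nu> \<Otimes>\<^sub>M P)) = char (distr P borel (\<lambda>x. limit_carrier x n)) t"
    proof -
      have "char (distr P borel (\<lambda>x. limit_carrier x n)) t = (\<integral>x. iexp (t * limit_carrier x n) \<partial>P)"
        by (simp add: char_def integral_distr)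
      also have "\<dots> = (\<integral>x. iexp (t * limit_carrier x n) \<partial>distr (\<nu> \<Otimes>\<^sub>M P) P snd)" by (simp only: snd)
      also have "\<dots> = (\<integral>z. iexp (t * limit_carrier (snd z) n) \<partial>(\<nu> \<Otimes>\<^sub>M P))"
        by (rule integral_distr) measurable
      finally show ?thesis by simp
    qed
    ultimately show "char (distr P borel (\<lambda>x. limit_carrier x n)) t = char \<nu> t"
      by (simp add: LIMSEQ_const_iff)
  qed
qed

text \<open>The test function \<open>f\<close> is what closes the induction: it records that the
  carrier leaving the window on the right has law \<nu> and is independent of the outputs inside the
  window.\<close>

lemma nn_integral_dynamics_window:
  assumes [measurable]: "f \<in> borel_measurable borel" and A [measurable]: "\<And>i. A i \<in> sets borel"
  shows "(\<integral>\<^sup>+x. (\<Prod>i\<in>{a<..a + int m}. indicator (A i) (dynamics x i)) * f (limit_carrier x (a + int m)) \<partial>P)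
     = (\<Prod>i\<in>{a<..a + int m}. emeasure \<mu> (A i)) * (\<integral>\<^sup>+u. f u \<partial>\<nu>)"
  using assms(1)
proof (induction m arbitrary: f)
  case 0
  note [measurable] = \<open>f \<in> borel_measurable borel\<close>
  have "(\<integral>\<^sup>+u. f u \<partial>\<nu>) = (\<integral>\<^sup>+u. f u \<partial>distr P borel (\<lambda>x. limit_carrier x a))" by (simp only: distr_limit_carrier)
  also have "\<dots> = (\<integral>\<^sup>+x. f (limit_carrier x a) \<partial>P)" by (rule nn_integral_distr) measurable
  finally show ?case by simp
next
  case (Suc m)
  note [measurable] = \<open>f \<in> borel_measurable borel\<close>
  define b where "b = a + int m"
  have b: "a + int (Suc m) = b + 1" by (simp add: b_def)
  have "{a<..a + int (Suc m)} = insert (b + 1) {a<..b}" by (auto simp: b_def)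
  then have prod_b: "prod h {a<..a + int (Suc m)} = prod h {a<..b} * h (b + 1)" for h :: "int \<Rightarrow> ennreal"
    by (simp only:) (subst prod.insert, simp_all add: mult.commute)
  define Z :: "(int \<Rightarrow> real) \<Rightarrow> ennreal" where "Z x = (\<Prod>i\<in>{a<..b}. indicator (A i) (dynamics x i))" for x
  have [measurable]: "Z \<in> borel_measurable P" unfolding Z_def by measurable
  define g where "g s v = indicator (A (b + 1)) (Fx s v) * f (Fu s v)" for s v
  have [measurable]: "(\<lambda>z. g (fst z) (snd z)) \<in> borel_measurable (borel \<Otimes>\<^sub>M borel)"
    "g s \<in> borel_measurable borel" for s
    unfolding g_def by measurable
  have "(\<integral>\<^sup>+x. (\<Prod>i\<in>{a<..a + int (Suc m)}. indicator (A i) (dynamics x i)) * f (limit_carrier x (a + int (Suc m))) \<partial>P)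
      = (\<integral>\<^sup>+x. Z x * g (x (b + 1)) (limit_carrier x b) \<partial>P)"
  proof (rule nn_integral_cong_AE)
    show "AE x in P. (\<Prod>i\<in>{a<..a + int (Suc m)}. indicator (A i) (dynamics x i)) * f (limit_carrier x (a + int (Suc m)))
       = Z x * g (x (b + 1)) (limit_carrier x b)"
      using AE_carrier_convergent
    proof eventually_elim
      case (elim x)
      have "limit_carrier x (b + 1) = Fu (x (b + 1)) (limit_carrier x b)"
        using carrier_solD(2)[OF limit_carrier_sol[OF elim], of "b + 1"] by simp
      moreover have "dynamics x (b + 1) = Fx (x (b + 1)) (limit_carrier x b)" by (simp add: dynamics_def step_def)
      ultimately show ?case
        unfolding prod_b Z_def g_def unfolding b by (simp add: mult_ac)
    qed
  qed
  \<comment> \<open>By causality, the outputs up to \<open>b\<close> and the carrier at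
    \<open>b\<close> ignore the coordinate \<open>b + 1\<close>.\<close>
  also have "\<dots> = (\<integral>\<^sup>+s. \<integral>\<^sup>+x. Z x * g s (limit_carrier x b) \<partial>P \<partial>\<mu>)"
  proof -
    have "(\<integral>\<^sup>+x. (\<lambda>s (z, v). z * g s v) (x (b + 1)) (Z x, limit_carrier x b) \<partial>P)
       = (\<integral>\<^sup>+s. \<integral>\<^sup>+x. (\<lambda>s (z, v). z * g s v) s (Z x, limit_carrier x b) \<partial>P \<partial>\<mu>)"
    proof (rule \<mu>.nn_integral_indep_coord[where N="borel \<Otimes>\<^sub>M borel"])
      show "(Z (x(b + 1 := s)), limit_carrier (x(b + 1 := s)) b) = (Z x, limit_carrier x b)" for x s
      proof -
        have "dynamics (x(b + 1 := s)) i = dynamics x i" if "i \<le> b" for i by (rule dynamics_cong) (use that in simp)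
        then have "Z (x(b + 1 := s)) = Z x" unfolding Z_def by (intro prod.cong) auto
        moreover have "limit_carrier (x(b + 1 := s)) b = limit_carrier x b" by (rule limit_carrier_cong) simp
        ultimately show ?thesis by simp
      qed
    qed (unfold g_def, measurable)
    then show ?thesis by simp
  qed
  \<comment> \<open>With \<open>s\<close> fixed, this is the induction hypothesis for the test
    function \<open>g s\<close>.\<close>
  also have "\<dots> = (\<integral>\<^sup>+s. (\<Prod>i\<in>{a<..b}. emeasure \<mu> (A i)) * (\<integral>\<^sup>+v. g s v \<partial>\<nu>) \<partial>\<mu>)"
    unfolding Z_def b_def by (intro nn_integral_cong Suc.IH) simp
  also have "\<dots> = (\<Prod>i\<in>{a<..b}. emeasure \<mu> (A i)) * (\<integral>\<^sup>+s. \<integral>\<^sup>+v. g s v \<partial>\<nu> \<partial>\<mu>)"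
    by (rule nn_integral_cmult) measurable
  also have "(\<integral>\<^sup>+s. \<integral>\<^sup>+v. g s v \<partial>\<nu> \<partial>\<mu>) = (\<integral>\<^sup>+s. \<integral>\<^sup>+v. indicator (A (b + 1)) s * f v \<partial>\<nu> \<partial>\<mu>)"
    unfolding g_def using F_preserves[of "\<lambda>z. indicator (A (b + 1)) (fst z) * f (snd z)"] by simp
  also have "\<dots> = emeasure \<mu> (A (b + 1)) * (\<integral>\<^sup>+v. f v \<partial>\<nu>)"
    by (simp add: nn_integral_cmult nn_integral_multc)
  finally show ?case unfolding prod_b by (simp add: mult_ac)
qed

lemma measurable_dynamics_P [measurable]: "dynamics \<in> measurable P P"
  by (rule \<mu>.measurable_P_I) measurable

lemma distr_dynamics: "distr P P dynamics = P"
proof (rule \<mu>.P.PiM_eq)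
  fix J :: "int set" and F :: "int \<Rightarrow> real set"
  assume J: "finite J" and F: "\<And>j. j \<in> J \<Longrightarrow> F j \<in> sets \<mu>"
  obtain a m where am: "J \<subseteq> {a<..a + int m}"
  proof -
    obtain l u where "\<And>j. j \<in> J \<Longrightarrow> l < j \<and> j \<le> u"
    proof
      fix j assume "j \<in> J"
      then have "Min (insert 0 J) \<le> j" "j \<le> Max (insert 0 J)" using J by auto
      then show "Min (insert 0 J) - 1 < j \<and> j \<le> Max (insert 0 J)" by simp
    qed
    then show ?thesis by (intro that[of l "nat (u - l)"]) force
  qed
  \<comment> \<open>Padding with the whole line at sites outside \<open>J\<close> turns a finite set
    of constraints into constraints on an interval; the padded factors are 1.\<close>
  define A where "A i = (if i \<in> J then F i else UNIV)" for i
  have A [measurable]: "A i \<in> sets borel" for i using F by (simp add: A_def)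
  have [measurable]: "prod_emb UNIV (\<lambda>_. \<mu>) J (\<Pi>\<^sub>E j\<in>J. F j) \<in> sets P"
    by (rule sets_PiM_I) (use J F in auto)
  have "emeasure (distr P P dynamics) (prod_emb UNIV (\<lambda>_. \<mu>) J (\<Pi>\<^sub>E j\<in>J. F j))
      = (\<integral>\<^sup>+x. indicator (prod_emb UNIV (\<lambda>_. \<mu>) J (\<Pi>\<^sub>E j\<in>J. F j)) (dynamics x) \<partial>P)"
    by (subst nn_integral_distr[OF measurable_dynamics_P, symmetric]) simp_all
  also have "\<dots> = (\<integral>\<^sup>+x. (\<Prod>i\<in>{a<..a + int m}. indicator (A i) (dynamics x i)) * 1 \<partial>P)"
  proof (intro nn_integral_cong)
    fix x
    have "dynamics x \<in> prod_emb UNIV (\<lambda>_. \<mu>) J (\<Pi>\<^sub>E j\<in>J. F j) \<longleftrightarrow> (\<forall>i\<in>{a<..a + int m}. dynamics x i \<in> A i)"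
      using am by (auto simp: prod_emb_def A_def PiE_iff)
    then show "indicator (prod_emb UNIV (\<lambda>_. \<mu>) J (\<Pi>\<^sub>E j\<in>J. F j)) (dynamics x)
       = (\<Prod>i\<in>{a<..a + int m}. indicator (A i) (dynamics x i)) * (1::ennreal)"
      by (auto simp: indicator_def prod_zero_iff intro!: prod.neutral)
  qed
  also have "\<dots> = (\<Prod>i\<in>{a<..a + int m}. emeasure \<mu> (A i))"
    using nn_integral_dynamics_window[of "\<lambda>_. 1" A a m] \<nu>.emeasure_space_1 by simp
  also have "\<dots> = (\<Prod>j\<in>J. emeasure \<mu> (F j))"
    by (rule prod.mono_neutral_cong_right)
      (use am \<mu>.emeasure_space_1 in \<open>auto simp: A_def\<close>)
  finally show "emeasure (distr P P dynamics) (prod_emb UNIV (\<lambda>_. \<mu>) J (\<Pi>\<^sub>E j\<in>J. F j))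
     = (\<Prod>j\<in>J. emeasure \<mu> (F j))" .
qed simp

text \<open>Off \<open>D\<close> the map is the identity, so a measurable \<open>D\<close> makes all
  of \<open>dK_T\<close> measurable. Then agreement with \<open>dynamics\<close> almost everywhere
  suffices.\<close>

lemma dK_invariantI:
  assumes "\<And>x. dK_defined \<alpha> \<beta> x \<longleftrightarrow> D x" "\<And>x. dK_T \<alpha> \<beta> x = (if D x then dynamics x else x)"
    and [measurable]: "Measurable.pred P D" and ae: "AE x in P. D x"
  shows "dK_invariant \<alpha> \<beta> \<mu>"
proof -
  have "dK_T \<alpha> \<beta> \<in> measurable P P"
    unfolding assms(2)[abs_def] by measurable
  then have "distr P P (dK_T \<alpha> \<beta>) = distr P P dynamics"
    using ae by (intro distr_cong_AE) (auto simp: assms(2))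
  then show ?thesis
    using ae by (simp add: dK_invariant_def assms(1) distr_dynamics)
qed

text \<open>As \<open>dynamics\<close> preserves \<open>P\<close>, a property that holds almost
  surely for \<open>x\<close> also holds almost surely for \<open>dynamics x\<close>.\<close>

lemma AE_dynamics_funpow:
  "AE x in P. carrier_convergent ((dynamics ^^ t) x)"
proof (induction t)
  case (Suc t)
  have "AE x in P. carrier_convergent ((dynamics ^^ t) (dynamics x))"
    by (rule AE_distrD[of dynamics P P]) (simp add: measurable_dynamics_P, simp only: distr_dynamics Suc)
  then show ?case by (simp add: funpow_swap1)
qed (simp add: AE_carrier_convergent)

end

section \<open>Invariance in the two regimes\<close>

locale stationary_dK_anti = stationary_dK + dK_anti
begin

lemma invariant: "dK_invariant \<alpha> \<beta> \<mu>"
  by (rule dK_invariantI[OF dK_defined_iff dK_T_eq measurable_carrier_convergent AE_carrier_convergent]) measurable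

end

locale stationary_dK_affine = stationary_dK + dK_affine
begin

lemma invariant: "dK_invariant \<alpha> \<beta> \<mu>"
proof (rule dK_invariantI[OF dK_defined_iff dK_T_eq])
  have r [measurable]: "refl_conf \<in> measurable P P"
    unfolding refl_conf_def[abs_def] by (rule \<mu>.measurable_P_I) measurable
  have T [measurable]: "(dynamics ^^ t) \<in> measurable P P" for t
    by (induction t) (auto simp: funpow_Suc_right id_def simp del: funpow.simps(2)
        intro: measurable_compose[OF measurable_dynamics_P, unfolded o_def])
  have carrier_convergent [measurable]: "Measurable.pred P carrier_convergent"
    by (rule measurable_carrier_convergent[of "\<lambda>x. x"]) measurable
  show "Measurable.pred P lattice_solvable"
    unfolding lattice_solvable_def by measurable
  \<comment> \<open>The past rows are iterates of the reflected configuration, which has the same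
    law, so the forward statement covers them.\<close>
  have "distr P P refl_conf = P"
    using \<mu>.distr_refl by (simp add: refl_conf_def[abs_def])
  then have "AE x in P. carrier_convergent ((dynamics ^^ t) (refl_conf x))" for t
    using AE_distrD[OF r, of "\<lambda>x. carrier_convergent ((dynamics ^^ t) x)"] AE_dynamics_funpow by (simp only: )
  then show "AE x in P. lattice_solvable x"
    unfolding lattice_solvable_def by (simp add: AE_conj_iff AE_all_countable AE_dynamics_funpow)
qed

end

section \<open>Almost sure decay of products\<close>

text \<open>The terms are eventually below 1, and there a power \<open>s \<le> 1\<close> only
  enlarges them. This lets a fractional moment replace a first moment.\<close>

lemma summable_of_powr:
  fixes a :: "nat \<Rightarrow> real"
  assumes "\<And>k. 0 \<le> a k" and s: "0 < s" "s \<le> 1" and sm: "summable (\<lambda>k. a k powr s)"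
  shows "summable a"
proof -
  have "(\<lambda>k. a k powr s) \<longlonglongrightarrow> 0" by (rule summable_LIMSEQ_zero[OF sm])
  then have "eventually (\<lambda>k. a k powr s < 1) sequentially"
    by (rule order_tendstoD) simp
  then have "eventually (\<lambda>k. norm (a k) \<le> a k powr s) sequentially"
  proof eventually_elim
    case (elim k)
    have "a k \<le> 1"
      using elim s ge_one_powr_ge_zero[of "a k" s] by (cases "1 \<le> a k") auto
    then have "a k powr 1 \<le> a k powr s"
      by (rule powr_mono'[OF s(2) assms(1)])
    then show ?case using assms(1)[of k] by simp
  qed
  then show ?thesis using sm by (rule summable_comparison_test_ev)
qed

text \<open>By convexity of exp, the difference quotients at 0 increase with \<open>s\<close> and
  lie above the derivative. The two bounds provide the domination for differentiating an exponential
  moment at 0.\<close>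

lemma exp_quotient_bounds:
  fixes y :: real
  assumes "0 < s" "s \<le> t"
  shows "y \<le> (exp (s * y) - 1) / s" "(exp (s * y) - 1) / s \<le> (exp (t * y) - 1) / t"
proof -
  have "1 + s * y \<le> exp (s * y)" by (rule exp_ge_add_one_self)
  then show "y \<le> (exp (s * y) - 1) / s" using assms by (simp add: field_simps)
  have t: "0 < t" using assms by simp
  have "exp ((1 - s / t) *\<^sub>R 0 + (s / t) *\<^sub>R (t * y)) \<le> (1 - s / t) * exp 0 + (s / t) * exp (t * y)"
    using assms t by (intro convex_onD[OF exp_convex]) auto
  then have "exp (s * y) - 1 \<le> (s / t) * (exp (t * y) - 1)"
    using t by (simp add: algebra_simps)
  then show "(exp (s * y) - 1) / s \<le> (exp (t * y) - 1) / t"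
    using assms t by (simp add: field_simps)
qed

lemma exp_quotient_tendsto:
  fixes y :: real
  assumes "s \<longlonglongrightarrow> 0" "\<And>i. 0 < s i"
  shows "(\<lambda>i. (exp (s i * y) - 1) / s i) \<longlonglongrightarrow> y"
proof -
  have "((\<lambda>h. exp (h * y)) has_field_derivative y) (at 0)"
    by (auto intro!: derivative_eq_intros)
  then have lim: "((\<lambda>h. (exp (h * y) - 1) / h) \<longlongrightarrow> y) (at 0)"
    by (simp add: has_field_derivative_iff)
  have "filterlim s (at 0) sequentially"
    unfolding filterlim_at using assms by (auto simp: less_imp_neq[THEN not_sym] eventually_sequentially)
  from filterlim_compose[OF lim this] show ?thesis .
qed

text \<open>The moment equals 1 at \<open>s = 0\<close> and has there the right derivative
  \<open>expectation Y < 0\<close>, so it drops below 1 for small positive \<open>s\<close>.\<close>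

lemma (in prob_space) exp_moment_less_1:
  fixes Y :: "'a \<Rightarrow> real"
  assumes Y: "integrable M Y" and t: "0 < t" "integrable M (\<lambda>x. exp (t * Y x))"
    and neg: "expectation Y < 0"
  obtains s where "0 < s" "s \<le> t" "integrable M (\<lambda>x. exp (s * Y x))" "expectation (\<lambda>x. exp (s * Y x)) < 1"
proof -
  have [measurable]: "Y \<in> borel_measurable M" using Y by auto
  define s where "s i = t / real (Suc i)" for i
  have s: "0 < s i" "s i \<le> t" for i
    using t by (simp_all add: s_def divide_le_eq mult_le_cancel_left1)
  have s0: "s \<longlonglongrightarrow> 0"
    unfolding s_def using LIMSEQ_Suc[OF lim_const_over_n[of t]] by simp
  define g where "g i x = (exp (s i * Y x) - 1) / s i" for i x
  have [measurable]: "g i \<in> borel_measurable M" for i unfolding g_def by measurable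
  have bound: "norm (g i x) \<le> \<bar>Y x\<bar> + exp (t * Y x) / t" for i x
  proof -
    note b = exp_quotient_bounds[where s="s i" and t=t and y="Y x", OF s]
    have "(exp (t * Y x) - 1) / t \<le> exp (t * Y x) / t" "0 \<le> exp (t * Y x) / t"
      using t by (simp_all add: divide_right_mono)
    then show ?thesis using b unfolding g_def by simp
  qed
  have int: "integrable M (\<lambda>x. \<bar>Y x\<bar> + exp (t * Y x) / t)" using Y t by simp
  have lim: "(\<lambda>i. expectation (g i)) \<longlonglongrightarrow> expectation Y"
  proof (rule integral_dominated_convergence[where w="\<lambda>x. \<bar>Y x\<bar> + exp (t * Y x) / t"])
    show "AE x in M. (\<lambda>i. g i x) \<longlonglongrightarrow> Y x"
      unfolding g_def using exp_quotient_tendsto[OF s0 s(1)] by simp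
  qed (use int bound in simp_all)
  have "eventually (\<lambda>i. expectation (g i) < 0) sequentially"
    using order_tendstoD(2)[OF lim neg] .
  then obtain i where i: "expectation (g i) < 0"
    using eventually_happens by fastforce
  have gi: "integrable M (g i)"
    by (rule Bochner_Integration.integrable_bound[OF int]) (use bound in \<open>auto intro: order_trans[OF _ abs_ge_self]\<close>)
  have e: "exp (s i * Y x) = s i * g i x + 1" for x using s(1)[of i] by (simp add: g_def)
  have "integrable M (\<lambda>x. exp (s i * Y x))" unfolding e using gi by simp
  moreover have "expectation (\<lambda>x. exp (s i * Y x)) < 1"
    unfolding e using gi i s(1)[of i] by (simp add: prob_space mult_pos_neg)
  ultimately show ?thesis using that[OF s[of i]] by blast
qed

section \<open>Decay of products along an i.i.d. sequence\<close>

context iid_sequence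
begin

lemma AE_P_pos:
  assumes "AE x in \<mu>. 0 < x"
  shows "AE x in P. \<forall>n. 0 < x n"
proof -
  have "AE x in P. 0 < x n" for n
    by (rule AE_PiM_component) (use assms prob_space_axioms in auto)
  then show ?thesis by (simp add: AE_all_countable)
qed

text \<open>The extra factor \<open>r\<close> at the far end drives the induction through the choice
  \<open>r = q\<close>, and carries the weight of the boundary site in the application.\<close>

lemma nn_integral_prod_window:
  assumes [measurable]: "q \<in> borel_measurable borel" "r \<in> borel_measurable borel"
  shows "(\<integral>\<^sup>+x. (\<Prod>j<k. q (x (n - int j))) * r (x (n - int k)) \<partial>P)
     = (\<integral>\<^sup>+s. q s \<partial>\<mu>) ^ k * (\<integral>\<^sup>+s. r s \<partial>\<mu>)"
  using assms(2)
proof (induction k arbitrary: r)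
  have *: "(\<integral>\<^sup>+x. (\<Prod>j<k. q (x (n - int j))) * r (x (n - int k)) \<partial>P)
     = (\<integral>\<^sup>+x. (\<Prod>j<k. q (x (n - int j))) \<partial>P) * (\<integral>\<^sup>+s. r s \<partial>\<mu>)"
    if [measurable]: "r \<in> borel_measurable borel" for r k
  proof -
    have "(\<integral>\<^sup>+x. (\<Prod>j<k. q (x (n - int j))) * r (x (n - int k)) \<partial>P)
      = (\<integral>\<^sup>+s. \<integral>\<^sup>+x. (\<Prod>j<k. q (x (n - int j))) * r s \<partial>P \<partial>\<mu>)"
      by (rule nn_integral_indep_coord[where N=borel and f="\<lambda>s v. v * r s"]) simp_all
    also have "\<dots> = (\<integral>\<^sup>+s. (\<integral>\<^sup>+x. (\<Prod>j<k. q (x (n - int j))) \<partial>P) * r s \<partial>\<mu>)"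
      by (simp add: nn_integral_multc)
    also have "\<dots> = (\<integral>\<^sup>+x. (\<Prod>j<k. q (x (n - int j))) \<partial>P) * (\<integral>\<^sup>+s. r s \<partial>\<mu>)"
      by (rule nn_integral_cmult) simp
    finally show ?thesis .
  qed
  {
    case 0
    then show ?case using *[of r 0] by simp
  next
    case (Suc k)
    have "(\<integral>\<^sup>+x. (\<Prod>j<Suc k. q (x (n - int j))) \<partial>P) = (\<integral>\<^sup>+s. q s \<partial>\<mu>) ^ Suc k"
      using Suc.IH[of q] by (simp add: mult.commute)
    then show ?case using *[OF Suc.prems, of "Suc k"] by simp
  }
qed

text \<open>By independence, the \<open>s\<close>-th power of the \<open>k\<close>-fold product has
  expectation \<open>\<rho> ^ k\<close> with \<open>\<rho> < 1\<close>. The weighted series of these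
  powers has finite expectation and so converges almost surely; taking \<open>s \<le> 1\<close>
  transfers this to the products themselves.\<close>

lemma AE_summable_products:
  assumes \<gamma>: "0 < \<gamma>" and pos: "AE x in \<mu>. 0 < x"
    and ln: "integrable \<mu> ln" "2 * (LINT x|\<mu>. ln x) < - ln \<gamma>"
    and s0: "0 < s0" "integrable \<mu> (\<lambda>x. x powr s0)"
  shows "AE x in P. \<forall>n. summable (\<lambda>k. x (n - int k) * (\<Prod>j<k. \<gamma> * (x (n - int j))\<^sup>2))
     \<and> (\<lambda>k. \<Prod>j<k. \<gamma> * (x (n - int j))\<^sup>2) \<longlonglongrightarrow> 0"
proof -
  define Y where "Y x = ln \<gamma> + 2 * ln x" for x :: real
  have [measurable]: "Y \<in> borel_measurable borel" unfolding Y_def by measurable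
  have Y: "integrable \<mu> Y" "expectation Y < 0" unfolding Y_def using ln prob_space by simp_all
  have expY: "exp (s * Y x) = (\<gamma> * x\<^sup>2) powr s" if "0 < x" for s x
    using that \<gamma> by (simp add: powr_def Y_def ln_mult ln_realpow)
  \<comment> \<open>The bound 1 is for \<open>summable_of_powr\<close>; the half is needed because
    \<open>exp (t * Y x)\<close> contains \<open>x powr (2 * t)\<close>.\<close>
  define t where "t = min 1 (s0 / 2)"
  have t: "0 < t" "t \<le> 1" "2 * t \<le> s0" using s0 by (auto simp: t_def)
  have powr_int: "integrable \<mu> (\<lambda>x. x powr s)" if s: "0 < s" "s \<le> s0" for s
  proof (rule Bochner_Integration.integrable_bound)
    show "integrable \<mu> (\<lambda>x. 1 + x powr s0)" using s0 by simp
    show "AE x in \<mu>. norm (x powr s) \<le> norm (1 + x powr s0)"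
      using pos
    proof eventually_elim
      case (elim x)
      have "x powr s \<le> 1 + x powr s0"
      proof (cases "x \<le> 1")
        case True
        then have "x powr s \<le> 1" using elim s powr_mono2[of s x 1] by simp
        then show ?thesis by (simp add: add_increasing2)
      next
        case False
        then show ?thesis using powr_mono[of s s0 x] s by (simp add: add_increasing)
      qed
      then show ?case by simp
    qed
  qed simp
  have "integrable \<mu> (\<lambda>x. exp (t * Y x))"
  proof (subst integrable_cong_AE)
    show "AE x in \<mu>. exp (t * Y x) = \<gamma> powr t * x powr (2 * t)"
      using pos
    proof eventually_elim
      case (elim x)
      have "(x\<^sup>2) powr t = x powr (2 * t)"
        using elim by (simp add: powr_powr flip: powr_numeral)
      then show ?case using elim \<gamma> by (simp add: expY powr_mult)
    qed
    show "integrable \<mu> (\<lambda>x. \<gamma> powr t * x powr (2 * t))"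
      using powr_int[of "2 * t"] t by simp
  qed simp_all
  from exp_moment_less_1[OF Y(1) t(1) this Y(2)]
  obtain s where s: "0 < s" "s \<le> t" "integrable \<mu> (\<lambda>x. exp (s * Y x))"
    and \<rho>1: "expectation (\<lambda>x. exp (s * Y x)) < 1" .
  define \<rho> where "\<rho> = expectation (\<lambda>x. exp (s * Y x))"
  have \<rho>0: "0 \<le> \<rho>" by (simp add: \<rho>_def)
  \<comment> \<open>The weight \<open>x powr s + 1\<close> dominates both required series at once:
    the one with the extra factor \<open>x (n - int k)\<close> and the one without.\<close>
  define C where "C = expectation (\<lambda>x. x powr s + 1)"
  have C0: "0 \<le> C" by (simp add: C_def)
  have Cint: "integrable \<mu> (\<lambda>x. x powr s + 1)"
    using powr_int[of s] s t s0 by simp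
  have "AE x in P. summable (\<lambda>k. (\<Prod>j<k. exp (s * Y (x (n - int j)))) * (x (n - int k) powr s + 1))" for n
  proof -
    let ?b = "\<lambda>x k. (\<Prod>j<k. exp (s * Y (x (n - int j)))) * (x (n - int k) powr s + 1)"
    have b0: "0 \<le> ?b x k" for x k by (simp add: prod_nonneg)
    have b: "ennreal (?b x k) = (\<Prod>j<k. ennreal (exp (s * Y (x (n - int j))))) * ennreal (x (n - int k) powr s + 1)" for x k
      by (simp add: ennreal_mult prod_ennreal prod_nonneg)
    have "(\<integral>\<^sup>+x. (\<Sum>k. ennreal (?b x k)) \<partial>P) = (\<Sum>k. \<integral>\<^sup>+x. ennreal (?b x k) \<partial>P)"
      by (rule nn_integral_suminf) measurable
    also have "\<dots> = (\<Sum>k. ennreal (\<rho> ^ k * C))"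
    proof (rule suminf_cong)
      fix k
      have "(\<integral>\<^sup>+x. ennreal (?b x k) \<partial>P)
         = (\<integral>\<^sup>+x. ennreal (exp (s * Y x)) \<partial>\<mu>) ^ k * (\<integral>\<^sup>+x. ennreal (x powr s + 1) \<partial>\<mu>)"
        unfolding b by (rule nn_integral_prod_window) measurable
      also have "(\<integral>\<^sup>+x. ennreal (exp (s * Y x)) \<partial>\<mu>) = ennreal \<rho>"
        unfolding \<rho>_def by (rule nn_integral_eq_integral) (use s in auto)
      also have "(\<integral>\<^sup>+x. ennreal (x powr s + 1) \<partial>\<mu>) = ennreal C"
        unfolding C_def by (rule nn_integral_eq_integral) (use Cint in auto)
      finally show "(\<integral>\<^sup>+x. ennreal (?b x k) \<partial>P) = ennreal (\<rho> ^ k * C)"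
        using \<rho>0 C0 by (simp add: ennreal_mult ennreal_power)
    qed
    also have "\<dots> \<noteq> top"
      using \<rho>0 \<rho>1 C0 by (intro ennreal_suminf_neq_top summable_mult2 summable_geometric) (simp_all add: \<rho>_def)
    finally have "AE x in P. (\<Sum>k. ennreal (?b x k)) \<noteq> \<infinity>"
      by (intro nn_integral_noteq_infinite) simp_all
    then show ?thesis
    proof eventually_elim
      case (elim x)
      then show ?case by (intro summable_suminf_not_top b0) simp
    qed
  qed
  then have "AE x in P. \<forall>n. summable (\<lambda>k. (\<Prod>j<k. exp (s * Y (x (n - int j)))) * (x (n - int k) powr s + 1))"
    by (simp add: AE_all_countable)
  then show ?thesis
    using AE_P_pos[OF pos]
  proof eventually_elim
    case (elim x)
    have x: "0 < x m" for m using elim by simp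
    show ?case
    proof
      fix n
      let ?p = "\<lambda>k. \<Prod>j<k. \<gamma> * (x (n - int j))\<^sup>2"
      have p: "0 < ?p k" for k using \<gamma> x by (auto intro!: prod_pos mult_pos_pos zero_less_power)
      have e: "(\<Prod>j<k. exp (s * Y (x (n - int j)))) = ?p k powr s" for k
        unfolding expY[OF x] by (rule prod_powr_distrib[symmetric])
      have sm: "summable (\<lambda>k. ?p k powr s * (x (n - int k) powr s + 1))"
        unfolding e[symmetric] using elim(1) by blast
      have bound: "norm ((a * b) powr s) \<le> b powr s * (a powr s + 1)"
        "norm (b powr s) \<le> b powr s * (a powr s + 1)" if "0 < a" "0 < b" for a b :: real
        using that by (simp_all add: powr_mult distrib_left mult.commute)
      have s1: "s \<le> 1" using s t by simp
      have sm1: "summable (\<lambda>k. (x (n - int k) * ?p k) powr s)"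
        by (rule summable_comparison_test'[OF sm, where N=0]) (rule bound(1)[OF x p])
      have "summable (\<lambda>k. x (n - int k) * ?p k)"
        by (rule summable_of_powr[OF less_imp_le[OF mult_pos_pos[OF x p]] s(1) s1 sm1])
      moreover have sm2: "summable (\<lambda>k. ?p k powr s)"
        by (rule summable_comparison_test'[OF sm, where N=0]) (rule bound(2)[OF x p])
      have "summable ?p"
        by (rule summable_of_powr[OF less_imp_le[OF p] s(1) s1 sm2])
      then have "?p \<longlonglongrightarrow> 0" by (rule summable_LIMSEQ_zero)
      ultimately show "summable (\<lambda>k. x (n - int k) * ?p k) \<and> ?p \<longlonglongrightarrow> 0" by simp
    qed
  qed
qed

end

section \<open>Generalised inverse Gaussian laws\<close>

lemma nn_integral_exp_substitution:
  fixes f :: "real \<Rightarrow> ennreal"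
  assumes [measurable]: "f \<in> borel_measurable borel"
  shows "(\<integral>\<^sup>+x. f x * indicator {0<..} x \<partial>lborel) = (\<integral>\<^sup>+a. f (exp a) * ennreal (exp a) \<partial>lborel)"
proof -
  \<comment> \<open>Compact intervals that correspond under exp and exhaust both sides; the
    substitution is made on each of them.\<close>
  let ?I = "\<lambda>n::nat. {exp (- real (Suc n))..exp (real (Suc n))}"
  let ?J = "\<lambda>n::nat. {- real (Suc n)..real (Suc n)}"
  have I: "(\<Union>n. ?I n) = {0<..}"
  proof (intro equalityI subsetI)
    fix x :: real assume "x \<in> {0<..}"
    then have x: "x = exp (ln x)" by simp
    obtain n where "\<bar>ln x\<bar> \<le> real n" using real_arch_simple by blast
    then have "- real (Suc n) \<le> ln x" "ln x \<le> real (Suc n)" by auto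
    then have "exp (- real (Suc n)) \<le> exp (ln x)" "exp (ln x) \<le> exp (real (Suc n))"
      by (simp_all only: exp_le_cancel_iff)
    then have "x \<in> ?I n" using x by simp
    then show "x \<in> (\<Union>n. ?I n)" by blast
  qed (auto intro: less_le_trans[OF exp_gt_zero])
  have J: "(\<Union>n. ?J n) = UNIV"
  proof (intro equalityI subsetI)
    fix x :: real
    obtain n where "\<bar>x\<bar> \<le> real n" using real_arch_simple by blast
    then have "x \<in> ?J n" by (simp add: abs_le_iff)
    then show "x \<in> (\<Union>n. ?J n)" by blast
  qed simp
  have monotone: "(\<integral>\<^sup>+x. g x * indicator (\<Union>n. A n) x \<partial>lborel)
      = (SUP n. \<integral>\<^sup>+x. g x * indicator (A n) x \<partial>lborel)"
    if [measurable]: "g \<in> borel_measurable borel" "\<And>n. A n \<in> sets borel" and "incseq A"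
    for g :: "real \<Rightarrow> ennreal" and A :: "nat \<Rightarrow> real set"
  proof -
    \<comment> \<open>Monotone convergence appears here as continuity from below of the measure with
      density \<open>g\<close>.\<close>
    have "range A \<subseteq> sets (density lborel g)" by auto
    from SUP_emeasure_incseq[OF this \<open>incseq A\<close>] show ?thesis by (simp add: emeasure_density)
  qed
  have "(\<integral>\<^sup>+x. f x * indicator {0<..} x \<partial>lborel) = (SUP n. \<integral>\<^sup>+x. f x * indicator (?I n) x \<partial>lborel)"
    unfolding I[symmetric]
  proof (rule monotone)
    show "incseq ?I"
      by (rule incseq_SucI) (simp only: atLeastatMost_subset_iff exp_le_cancel_iff, simp)
  qed simp_all
  also have "\<dots> = (SUP n. \<integral>\<^sup>+a. (f (exp a) * ennreal (exp a)) * indicator (?J n) a \<partial>lborel)"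
  proof (intro SUP_cong refl)
    fix n :: nat
    show "(\<integral>\<^sup>+x. f x * indicator (?I n) x \<partial>lborel)
        = (\<integral>\<^sup>+a. (f (exp a) * ennreal (exp a)) * indicator (?J n) a \<partial>lborel)"
      by (rule nn_integral_substitution_aux) (auto intro!: derivative_eq_intros continuous_intros)
  qed
  also have "\<dots> = (\<integral>\<^sup>+a. (f (exp a) * ennreal (exp a)) * indicator (\<Union>n. ?J n) a \<partial>lborel)"
    by (rule monotone[symmetric]) (auto intro!: incseq_SucI)
  finally show ?thesis unfolding J by simp
qed

lemma nn_integral_real_reflect:
  fixes f :: "real \<Rightarrow> ennreal"
  assumes [measurable]: "f \<in> borel_measurable borel"
  shows "(\<integral>\<^sup>+x. f (t - x) \<partial>lborel) = (\<integral>\<^sup>+x. f x \<partial>lborel)"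
  using nn_integral_real_affine[OF assms, of "- 1" t] by simp

lemma nn_integral_real_translate:
  fixes f :: "real \<Rightarrow> ennreal"
  assumes [measurable]: "f \<in> borel_measurable borel"
  shows "(\<integral>\<^sup>+x. f (x - t) \<partial>lborel) = (\<integral>\<^sup>+x. f x \<partial>lborel)"
  using nn_integral_real_affine[OF assms, of 1 "- t"] by simp

text \<open>In logarithmic coordinates the map preserves \<open>a + b\<close>, and for fixed \<open>a + b\<close> it is a
  reflection in \<open>a\<close>.\<close>
lemma nn_integral_log_involution:
  fixes \<phi> :: "real \<times> real \<Rightarrow> ennreal"
  assumes [measurable]: "\<phi> \<in> borel_measurable (borel \<Otimes>\<^sub>M borel)" "l \<in> borel_measurable borel"
  shows "(\<integral>\<^sup>+a. \<integral>\<^sup>+b. \<phi> (b - l (a + b), a + l (a + b)) \<partial>lborel \<partial>lborel) = (\<integral>\<^sup>+a. \<integral>\<^sup>+b. \<phi> (a, b) \<partial>lborel \<partial>lborel)"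
proof -
  have shear: "(\<integral>\<^sup>+a. \<integral>\<^sup>+b. \<psi> a b \<partial>lborel \<partial>lborel) = (\<integral>\<^sup>+s. \<integral>\<^sup>+a. \<psi> a (s - a) \<partial>lborel \<partial>lborel)"
    if [measurable]: "(\<lambda>z. \<psi> (fst z) (snd z)) \<in> borel_measurable (borel \<Otimes>\<^sub>M borel)"
    for \<psi> :: "real \<Rightarrow> real \<Rightarrow> ennreal"
  proof -
    have [measurable]: "\<psi> a \<in> borel_measurable borel" for a
      using measurable_compose[OF _ that, of "\<lambda>b. (a, b)"] by simp
    have "(\<integral>\<^sup>+b. \<psi> a b \<partial>lborel) = (\<integral>\<^sup>+s. \<psi> a (s - a) \<partial>lborel)" for a
      by (rule nn_integral_real_translate[symmetric]) simp
    then have "(\<integral>\<^sup>+a. \<integral>\<^sup>+b. \<psi> a b \<partial>lborel \<partial>lborel) = (\<integral>\<^sup>+a. \<integral>\<^sup>+s. \<psi> a (s - a) \<partial>lborel \<partial>lborel)"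
      by simp
    also have "\<dots> = (\<integral>\<^sup>+s. \<integral>\<^sup>+a. \<psi> a (s - a) \<partial>lborel \<partial>lborel)"
    proof (rule lborel_pair.Fubini'[of "\<lambda>s a. \<psi> a (s - a)"])
      have "(\<lambda>z. (snd z, fst z - snd z)) \<in> measurable (borel \<Otimes>\<^sub>M borel) (borel \<Otimes>\<^sub>M (borel :: real measure))"
        by measurable
      from measurable_compose[OF this that]
      show "(\<lambda>(s, a). \<psi> a (s - a)) \<in> borel_measurable (lborel \<Otimes>\<^sub>M lborel)"
        by (simp add: split_def cong: measurable_cong_sets)
    qed
    finally show ?thesis .
  qed
  have "(\<integral>\<^sup>+a. \<integral>\<^sup>+b. \<phi> (b - l (a + b), a + l (a + b)) \<partial>lborel \<partial>lborel)
     = (\<integral>\<^sup>+s. \<integral>\<^sup>+a. \<phi> (s - a - l s, a + l s) \<partial>lborel \<partial>lborel)"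
    by (subst shear) simp_all
  also have "\<dots> = (\<integral>\<^sup>+s. \<integral>\<^sup>+a. \<phi> (a, s - a) \<partial>lborel \<partial>lborel)"
  proof (rule nn_integral_cong)
    fix s :: real
    have "(\<integral>\<^sup>+a. \<phi> ((s - l s) - a, s - ((s - l s) - a)) \<partial>lborel) = (\<integral>\<^sup>+a. \<phi> (a, s - a) \<partial>lborel)"
      by (rule nn_integral_real_reflect) measurable
    then show "(\<integral>\<^sup>+a. \<phi> (s - a - l s, a + l s) \<partial>lborel) = (\<integral>\<^sup>+a. \<phi> (a, s - a) \<partial>lborel)"
      by (simp add: algebra_simps)
  qed
  also have "\<dots> = (\<integral>\<^sup>+a. \<integral>\<^sup>+b. \<phi> (a, b) \<partial>lborel \<partial>lborel)"
    by (subst shear) simp_all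
  finally show ?thesis .
qed

section \<open>Kernels, normalisation and moments\<close>

definition gig_kernel :: "real \<Rightarrow> real \<Rightarrow> real \<Rightarrow> real \<Rightarrow> real" where
  "gig_kernel lam c1 c2 x = (if x > 0 then x powr (- lam - 1) * exp (- c1 * x - c2 / x) else 0)"

lemma GIG_kernel: "GIG lam c1 c2 = normalized_density (gig_kernel lam c1 c2)"
  by (simp add: GIG_def gig_kernel_def[abs_def])

text \<open>In this parametrisation IG is the inverse gamma law. It is the boundary case
  \<open>c1 = 0\<close>, so one kernel serves both families.\<close>

lemma IG_kernel: "IG lam c = normalized_density (gig_kernel lam 0 c)"
  unfolding IG_def gig_kernel_def[abs_def] by (intro arg_cong[where f=normalized_density]) (simp add: fun_eq_iff)

lemma measurable_gig_kernel [measurable]: "gig_kernel lam c1 c2 \<in> borel_measurable borel"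
  unfolding gig_kernel_def[abs_def] by measurable

lemma gig_kernel_nonneg: "0 \<le> gig_kernel lam c1 c2 x"
  by (simp add: gig_kernel_def)

text \<open>The right-hand side is the maximum of the left-hand side over \<open>y\<close>, attained
  at \<open>y = p / c\<close>.\<close>

lemma powr_exp_le:
  fixes p c y :: real
  assumes "0 < p" "0 < c" "0 < y"
  shows "y powr p * exp (- c * y) \<le> exp (p * ln (p / c) - p)"
proof -
  have "ln (c * y / p) \<le> c * y / p - 1" using assms by (intro ln_le_minus_one) simp
  then have "p * ln (c * y / p) \<le> p * (c * y / p - 1)" using assms by (intro mult_left_mono) auto
  moreover have "ln (c * y / p) = ln y - ln (p / c)" using assms by (simp add: ln_mult ln_div)
  ultimately have "p * ln y - c * y \<le> p * ln (p / c) - p" using assms by (simp add: algebra_simps)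
  moreover have "y powr p * exp (- c * y) = exp (p * ln y - c * y)"
    using assms by (simp add: powr_def flip: exp_add)
  ultimately show ?thesis by simp
qed

lemma integrable_gig_kernel:
  assumes "0 < lam" "0 \<le> c1" "0 < c2"
  shows "integrable lborel (gig_kernel lam c1 c2)"
proof (rule integrableI_nonneg)
  \<comment> \<open>The maximum of \<open>y powr (lam + 1) * exp (- c2 * y)\<close>, used with
    \<open>y = 1 / x\<close> to bound the kernel near 0; beyond 1 the power alone is
    integrable.\<close>
  define C where "C = exp ((lam + 1) * ln ((lam + 1) / c2) - (lam + 1))"
  have "(\<integral>\<^sup>+x. ennreal (gig_kernel lam c1 c2 x) \<partial>lborel)
    \<le> (\<integral>\<^sup>+x. ennreal C * indicator {0..1} x + ennreal (x powr (- lam - 1)) * indicator {1..} x \<partial>lborel)"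
  proof (rule nn_integral_mono)
    fix x :: real
    consider "x \<le> 0" | "0 < x" "x \<le> 1" | "1 < x" by linarith
    then show "ennreal (gig_kernel lam c1 c2 x)
      \<le> ennreal C * indicator {0..1} x + ennreal (x powr (- lam - 1)) * indicator {1..} x"
    proof cases
      case 2
      have "gig_kernel lam c1 c2 x \<le> (1 / x) powr (lam + 1) * exp (- c2 * (1 / x))"
        using 2 assms by (simp add: gig_kernel_def powr_minus powr_divide divide_simps flip: powr_minus_divide)
      also have "\<dots> \<le> C"
        unfolding C_def by (rule powr_exp_le) (use 2 assms in auto)
      finally show ?thesis using 2 by (auto simp: indicator_def ennreal_leI add_increasing2)
    next
      case 3
      have "0 \<le> c1 * x" "0 \<le> c2 / x" using 3 assms by auto
      then have "exp (- c1 * x - c2 / x) \<le> 1" by simp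
      then have "gig_kernel lam c1 c2 x \<le> x powr (- lam - 1)"
        using 3 by (simp add: gig_kernel_def mult_left_le)
      then show ?thesis using 3 by (simp add: ennreal_leI)
    qed (simp add: gig_kernel_def)
  qed
  also have "\<dots> = (\<integral>\<^sup>+x. ennreal C * indicator {0..1::real} x \<partial>lborel)
      + (\<integral>\<^sup>+x. ennreal (x powr (- lam - 1)) * indicator {1..} x \<partial>lborel)"
    by (rule nn_integral_add) measurable
  also have "(\<integral>\<^sup>+x. ennreal C * indicator {0..1::real} x \<partial>lborel) = ennreal C"
    by (simp add: nn_integral_cmult)
  also have "(\<integral>\<^sup>+x. ennreal (x powr (- lam - 1)) * indicator {1..} x \<partial>lborel)
      = ennreal (0 - (- (1 powr (- lam) / lam)))"
  proof (rule nn_integral_FTC_atLeast)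
    show "((\<lambda>x. - (x powr (- lam) / lam)) has_real_derivative x powr (- lam - 1)) (at x)" if "1 \<le> x" for x
      using that assms by (auto intro!: derivative_eq_intros simp: powr_diff field_simps)
    have "((\<lambda>x. x powr (- lam)) \<longlongrightarrow> 0) at_top"
      using assms by (intro tendsto_neg_powr filterlim_ident) auto
    from tendsto_minus[OF tendsto_divide_zero[OF this, of lam]]
    show "((\<lambda>x. - (x powr (- lam) / lam)) \<longlongrightarrow> 0) at_top" by simp
  qed simp_all
  also have "ennreal C + \<dots> < \<infinity>" by simp
  finally show "(\<integral>\<^sup>+x. ennreal (gig_kernel lam c1 c2 x) \<partial>lborel) < \<infinity>" .
qed (simp_all add: gig_kernel_nonneg)

locale gig_law =
  fixes lam c1 c2 :: real
  assumes lam: "0 < lam" and c1: "0 \<le> c1" and c2: "0 < c2"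
begin

definition Z :: real where "Z = (LINT x|lborel. gig_kernel lam c1 c2 x)"

definition M :: "real measure" where "M = normalized_density (gig_kernel lam c1 c2)"

text \<open>The unnormalised density of the logarithm; the Jacobian \<open>exp a\<close> changes the
  exponent from \<open>- lam - 1\<close> to \<open>- lam\<close>.\<close>

definition w :: "real \<Rightarrow> real" where "w a = exp (- lam * a - c1 * exp a - c2 * exp (- a))"

lemma nn_integral_kernel: "(\<integral>\<^sup>+x. ennreal (gig_kernel lam c1 c2 x) \<partial>lborel) = ennreal Z"
  unfolding Z_def by (intro nn_integral_eq_integral integrable_gig_kernel lam c1 c2) (simp add: gig_kernel_nonneg)

lemma Z_pos: "0 < Z"
proof (rule ccontr)
  assume "\<not> 0 < Z"
  then have "(\<integral>\<^sup>+x. ennreal (gig_kernel lam c1 c2 x) \<partial>lborel) = 0"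
    unfolding nn_integral_kernel by (simp add: ennreal_neg)
  then have "AE x in lborel. ennreal (gig_kernel lam c1 c2 x) = 0"
    by (subst (asm) nn_integral_0_iff_AE) simp_all
  then have "AE x in lborel. x \<notin> {1..2::real}"
    by eventually_elim (auto simp: gig_kernel_def)
  then have "emeasure lborel {1..2::real} = 0"
    by (subst (asm) AE_iff_measurable[of "{1..2}"]) auto
  then show False by simp
qed

lemma M_density: "M = density lborel (\<lambda>x. ennreal (gig_kernel lam c1 c2 x / Z))"
  by (simp add: M_def normalized_density_def Z_def)

lemma sets_M [simp, measurable_cong]: "sets M = sets borel"
  by (simp add: M_density)

lemma space_M [simp]: "space M = UNIV"
  by (simp add: M_density)

lemma prob_space_M: "prob_space M"
proof
  have "emeasure M (space M) = (\<integral>\<^sup>+x. ennreal (gig_kernel lam c1 c2 x / Z) \<partial>lborel)"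
    by (simp add: M_density emeasure_density)
  also have "\<dots> = (\<integral>\<^sup>+x. ennreal (gig_kernel lam c1 c2 x) / ennreal Z \<partial>lborel)"
    using Z_pos by (simp add: divide_ennreal gig_kernel_nonneg)
  also have "\<dots> = ennreal Z / ennreal Z"
    by (simp add: nn_integral_divide nn_integral_kernel)
  finally show "emeasure M (space M) = 1" using Z_pos by (simp add: divide_ennreal)
qed

lemma real_distribution_M: "real_distribution M"
  using prob_space_M by (simp add: real_distribution_def real_distribution_axioms_def)

lemma AE_M_pos: "AE x in M. 0 < x"
  unfolding M_density by (subst AE_density) (auto simp: gig_kernel_def intro!: AE_I2)

lemma integrable_M_iff:
  assumes [measurable]: "h \<in> borel_measurable borel"
  shows "integrable M h \<longleftrightarrow> integrable lborel (\<lambda>x. gig_kernel lam c1 c2 x * h x)"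
proof -
  have "integrable M h \<longleftrightarrow> integrable lborel (\<lambda>x. gig_kernel lam c1 c2 x / Z * h x)"
    unfolding M_density using Z_pos
    by (subst integrable_density) (simp_all add: gig_kernel_nonneg)
  also have "(\<lambda>x. gig_kernel lam c1 c2 x / Z * h x) = (\<lambda>x. inverse Z * (gig_kernel lam c1 c2 x * h x))"
    by (simp add: field_simps)
  finally show ?thesis unfolding integrable_mult_left_iff using Z_pos by simp
qed

text \<open>Multiplying the kernel by a power only shifts \<open>lam\<close>; half of
  \<open>lam\<close> is taken so that the shifted parameter stays positive.\<close>

lemma integrable_powr: "integrable M (\<lambda>x. x powr (lam / 2))"
proof -
  have "gig_kernel lam c1 c2 x * x powr (lam / 2) = gig_kernel (lam / 2) c1 c2 x" for x
    by (simp add: gig_kernel_def mult_ac flip: powr_add)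
  then show ?thesis
    using integrable_gig_kernel[of "lam / 2" c1 c2] lam c1 c2 by (simp add: integrable_M_iff)
qed

lemma integrable_inverse: "integrable M (\<lambda>x. x powr - 1)"
proof -
  have e: "x powr (- (lam + 1) - 1) = x powr (- lam - 1) * x powr - 1" for x :: real
    unfolding powr_add[symmetric] by simp
  have "gig_kernel lam c1 c2 x * x powr - 1 = gig_kernel (lam + 1) c1 c2 x" for x
    unfolding gig_kernel_def e by simp
  then show ?thesis
    using integrable_gig_kernel[of "lam + 1" c1 c2] lam c1 c2 by (simp add: integrable_M_iff)
qed

text \<open>A small positive power dominates the logarithm near infinity, and the inverse dominates
  it near 0.\<close>

lemma integrable_ln: "integrable M ln"
proof (rule Bochner_Integration.integrable_bound)
  show "integrable M (\<lambda>x. x powr (lam / 2) / (lam / 2) + x powr - 1)"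
    using integrable_powr integrable_inverse lam by simp
  show "AE x in M. norm (ln x) \<le> norm (x powr (lam / 2) / (lam / 2) + x powr - 1)"
    using AE_M_pos
  proof eventually_elim
    case (elim x)
    have a: "ln y \<le> y powr s / s" if "0 < s" "0 < y" for y s :: real
      using ln_le_minus_one[of "y powr s"] that by (simp add: ln_powr field_simps)
    have "ln x \<le> x powr (lam / 2) / (lam / 2)" using a[of "lam / 2" x] elim lam by simp
    moreover have "- ln x \<le> x powr - 1" using a[of 1 "1 / x"] elim by (simp add: ln_div powr_minus_divide)
    moreover have "0 \<le> x powr (lam / 2) / (lam / 2)" "0 \<le> x powr - 1" using lam by simp_all
    ultimately show ?case unfolding real_norm_def by linarith
  qed
qed simp

lemma nn_integral_M:
  assumes [measurable]: "f \<in> borel_measurable borel"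
  shows "(\<integral>\<^sup>+x. f x \<partial>M) = (\<integral>\<^sup>+a. f (exp a) * ennreal (w a / Z) \<partial>lborel)"
proof -
  have "(\<integral>\<^sup>+x. f x \<partial>M) = (\<integral>\<^sup>+x. ennreal (gig_kernel lam c1 c2 x / Z) * f x \<partial>lborel)"
    unfolding M_density by (rule nn_integral_density) measurable
  also have "\<dots> = (\<integral>\<^sup>+x. (ennreal (gig_kernel lam c1 c2 x / Z) * f x) * indicator {0<..} x \<partial>lborel)"
    by (intro nn_integral_cong) (auto simp: gig_kernel_def indicator_def)
  also have "\<dots> = (\<integral>\<^sup>+a. (ennreal (gig_kernel lam c1 c2 (exp a) / Z) * f (exp a)) * ennreal (exp a) \<partial>lborel)"
    by (rule nn_integral_exp_substitution) measurable
  also have "\<dots> = (\<integral>\<^sup>+a. f (exp a) * ennreal (w a / Z) \<partial>lborel)"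
  proof (intro nn_integral_cong)
    fix a :: real
    have "gig_kernel lam c1 c2 (exp a) * exp a = w a"
      by (simp add: gig_kernel_def w_def powr_def exp_minus divide_inverse algebra_simps flip: exp_add)
    then have "ennreal (gig_kernel lam c1 c2 (exp a) / Z) * ennreal (exp a) = ennreal (w a / Z)"
      by (simp flip: ennreal_mult'')
    then show "(ennreal (gig_kernel lam c1 c2 (exp a) / Z) * f (exp a)) * ennreal (exp a) = f (exp a) * ennreal (w a / Z)"
      by (metis mult.assoc mult.commute)
  qed
  finally show ?thesis .
qed

end

section \<open>The three families of invariant measures\<close>

lemma (in dK) stationary_dKI:
  assumes \<mu>: "real_distribution \<mu>" "AE x in \<mu>. 0 < x" and \<nu>: "real_distribution \<nu>" "AE u in \<nu>. 0 < u"
    and F: "\<And>f. f \<in> borel_measurable (borel \<Otimes>\<^sub>M borel) \<Longrightarrow>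
      (\<integral>\<^sup>+x. \<integral>\<^sup>+u. f (Fx x u, Fu x u) \<partial>\<nu> \<partial>\<mu>) = (\<integral>\<^sup>+x. \<integral>\<^sup>+u. f (x, u) \<partial>\<nu> \<partial>\<mu>)"
    and sm: "AE x in Pi\<^sub>M UNIV (\<lambda>_::int. \<mu>). \<forall>n.
       summable (\<lambda>k. x (n - int k) * (\<Prod>j<k. \<bar>\<alpha> - \<beta>\<bar> * (x (n - int j))\<^sup>2))
     \<and> (\<lambda>k. \<Prod>j<k. \<bar>\<alpha> - \<beta>\<bar> * (x (n - int j))\<^sup>2) \<longlonglongrightarrow> 0"
  shows "stationary_dK \<alpha> \<beta> \<mu> \<nu>"
proof -
  interpret \<mu>: iid_sequence \<mu> using \<mu>(1) by (simp add: iid_sequence_def)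
  interpret \<nu>: real_distribution \<nu> by (rule \<nu>(1))
  show ?thesis
  proof
    show "AE x in \<mu>.P. carrier_convergent x"
      using sm \<mu>.AE_P_pos[OF \<mu>(2)] by eventually_elim (rule carrier_from_convergence, auto)
    show "AE x in \<mu>.P. \<forall>n u. 0 < u \<longrightarrow> (\<lambda>k. carrier_from u k x n) \<longlonglongrightarrow> limit_carrier x n"
      using sm \<mu>.AE_P_pos[OF \<mu>(2)]
      by eventually_elim (intro allI impI, rule carrier_from_convergence, auto)
  qed (use \<nu>(2) F in auto)
qed

text \<open>F exchanges its arguments and the dynamics is the shift. The Lipschitz constant is 0, so
  of all products only the empty one survives.\<close>

lemma invariant_equal_parameters:
  assumes "0 \<le> \<alpha>" and \<mu>: "real_distribution \<mu>" "AE x in \<mu>. 0 < x"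
  shows "dK_invariant \<alpha> \<alpha> \<mu>"
proof -
  interpret dK \<alpha> \<alpha> by standard fact+
  interpret \<mu>: real_distribution \<mu> by fact
  interpret \<mu>\<mu>: pair_prob_space \<mu> \<mu> ..
  have F: "Fx x u = u" "Fu x u = x" if "0 < x" "0 < u" for x u
    using den_pos(1)[of x u] that by (simp_all add: Fx_def Fu_def)
  have "stationary_dK \<alpha> \<alpha> \<mu> \<mu>"
  proof (rule stationary_dKI[OF \<mu> \<mu>])
    fix f :: "real \<times> real \<Rightarrow> ennreal" assume [measurable]: "f \<in> borel_measurable (borel \<Otimes>\<^sub>M borel)"
    have "(\<integral>\<^sup>+x. \<integral>\<^sup>+u. f (Fx x u, Fu x u) \<partial>\<mu> \<partial>\<mu>) = (\<integral>\<^sup>+x. \<integral>\<^sup>+u. f (u, x) \<partial>\<mu> \<partial>\<mu>)"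
    proof (rule nn_integral_cong_AE)
      show "AE x in \<mu>. (\<integral>\<^sup>+u. f (Fx x u, Fu x u) \<partial>\<mu>) = (\<integral>\<^sup>+u. f (u, x) \<partial>\<mu>)"
        using \<mu>(2)
      proof eventually_elim
        case (elim x)
        show ?case
          by (rule nn_integral_cong_AE) (use \<mu>(2) elim in \<open>auto simp: F\<close>)
      qed
    qed
    also have "\<dots> = (\<integral>\<^sup>+x. \<integral>\<^sup>+u. f (x, u) \<partial>\<mu> \<partial>\<mu>)"
      by (rule \<mu>\<mu>.Fubini') measurable
    finally show "(\<integral>\<^sup>+x. \<integral>\<^sup>+u. f (Fx x u, Fu x u) \<partial>\<mu> \<partial>\<mu>) = (\<integral>\<^sup>+x. \<integral>\<^sup>+u. f (x, u) \<partial>\<mu> \<partial>\<mu>)" .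
  next
    have z: "(\<Prod>j<k. \<bar>\<alpha> - \<alpha>\<bar> * (x (n - int j))\<^sup>2) = (if k = 0 then 1 else 0)" for x :: "int \<Rightarrow> real" and n k
      by (cases k) simp_all
    have "(\<lambda>k. if k = 0 then 1 else 0 :: real) \<longlonglongrightarrow> 0"
      by (rule LIMSEQ_offset[of _ 1]) simp
    then show "AE x in Pi\<^sub>M UNIV (\<lambda>_::int. \<mu>). \<forall>n.
       summable (\<lambda>k. x (n - int k) * (\<Prod>j<k. \<bar>\<alpha> - \<alpha>\<bar> * (x (n - int j))\<^sup>2))
     \<and> (\<lambda>k. \<Prod>j<k. \<bar>\<alpha> - \<alpha>\<bar> * (x (n - int j))\<^sup>2) \<longlonglongrightarrow> 0"
      unfolding z by (auto intro!: AE_I2 summable_finite[of "{0}"] split: if_splits)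
  qed
  then interpret stationary_dK_anti \<alpha> \<alpha> \<mu> \<mu>
    by (simp add: stationary_dK_anti_def dK_anti_def dK_anti_axioms_def dK_axioms)
  show ?thesis by (rule invariant)
qed

text \<open>A form of the Matsumoto--Yor property: in the variables \<open>1 / u\<close> and \<open>\<alpha> x\<close>, the map is
  \<open>(X, Y) \<mapsto> (1 / (X + Y), 1 / X - 1 / (X + Y))\<close> up to scaling.\<close>
lemma gig_F_preserves:
  assumes "0 < \<alpha>" "0 < lam" "0 < c" and [measurable]: "f \<in> borel_measurable (borel \<Otimes>\<^sub>M borel)"
  shows "(\<integral>\<^sup>+x. \<integral>\<^sup>+u. f (u / (1 + \<alpha> * x * u), x * (1 + \<alpha> * x * u))
      \<partial>gig_law.M lam 0 c \<partial>gig_law.M lam (c * \<alpha>) c)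
    = (\<integral>\<^sup>+x. \<integral>\<^sup>+u. f (x, u) \<partial>gig_law.M lam 0 c \<partial>gig_law.M lam (c * \<alpha>) c)"
proof -
  interpret \<mu>: gig_law lam "c * \<alpha>" c by standard (use assms in auto)
  interpret \<nu>: gig_law lam 0 c by standard (use assms in auto)
  have both: "(\<integral>\<^sup>+x. \<integral>\<^sup>+u. g (x, u) \<partial>\<nu>.M \<partial>\<mu>.M)
      = (\<integral>\<^sup>+a. \<integral>\<^sup>+b. g (exp a, exp b) * ennreal (\<mu>.w a / \<mu>.Z * (\<nu>.w b / \<nu>.Z)) \<partial>lborel \<partial>lborel)"
    if [measurable]: "g \<in> borel_measurable (borel \<Otimes>\<^sub>M borel)" for g
  proof -
    interpret real_distribution \<nu>.M by (rule \<nu>.real_distribution_M)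
    have [measurable]: "\<mu>.w \<in> borel_measurable borel" "\<nu>.w \<in> borel_measurable borel"
      unfolding \<mu>.w_def[abs_def] \<nu>.w_def[abs_def] by measurable
    have "(\<integral>\<^sup>+x. \<integral>\<^sup>+u. g (x, u) \<partial>\<nu>.M \<partial>\<mu>.M)
       = (\<integral>\<^sup>+a. (\<integral>\<^sup>+u. g (exp a, u) \<partial>\<nu>.M) * ennreal (\<mu>.w a / \<mu>.Z) \<partial>lborel)"
      by (rule \<mu>.nn_integral_M) measurable
    also have "\<dots> = (\<integral>\<^sup>+a. (\<integral>\<^sup>+b. g (exp a, exp b) * ennreal (\<nu>.w b / \<nu>.Z) \<partial>lborel) * ennreal (\<mu>.w a / \<mu>.Z) \<partial>lborel)"
      by (subst \<nu>.nn_integral_M) simp_all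
    also have "\<dots> = (\<integral>\<^sup>+a. \<integral>\<^sup>+b. g (exp a, exp b) * ennreal (\<nu>.w b / \<nu>.Z) * ennreal (\<mu>.w a / \<mu>.Z) \<partial>lborel \<partial>lborel)"
      by (subst nn_integral_multc) simp_all
    also have "\<dots> = (\<integral>\<^sup>+a. \<integral>\<^sup>+b. g (exp a, exp b) * ennreal (\<mu>.w a / \<mu>.Z * (\<nu>.w b / \<nu>.Z)) \<partial>lborel \<partial>lborel)"
    proof -
      have "0 \<le> \<mu>.w a / \<mu>.Z" "0 \<le> \<nu>.w b / \<nu>.Z" for a b
        using \<mu>.Z_pos \<nu>.Z_pos by (simp_all add: \<mu>.w_def \<nu>.w_def)
      then show ?thesis by (simp only: ennreal_mult mult_ac)
    qed
    finally show ?thesis .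
  qed
  \<comment> \<open>The logarithm of the factor \<open>1 + \<alpha> * x * u\<close>, which depends
    only on the conserved sum of the logarithms.\<close>
  define l where "l s = ln (1 + \<alpha> * exp s)" for s
  have [measurable]: "l \<in> borel_measurable borel" unfolding l_def[abs_def] by measurable
  define \<phi> where "\<phi> z = f (exp (fst z), exp (snd z)) * ennreal (\<mu>.w (fst z) / \<mu>.Z * (\<nu>.w (snd z) / \<nu>.Z))" for z
  have [measurable]: "\<phi> \<in> borel_measurable (borel \<Otimes>\<^sub>M borel)"
    unfolding \<phi>_def[abs_def] \<mu>.w_def \<nu>.w_def by measurable
  have "f (exp b / (1 + \<alpha> * exp a * exp b), exp a * (1 + \<alpha> * exp a * exp b)) * ennreal (\<mu>.w a / \<mu>.Z * (\<nu>.w b / \<nu>.Z))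
    = \<phi> (b - l (a + b), a + l (a + b))" for a b
  proof -
    define m where "m = 1 + \<alpha> * exp (a + b)"
    have m: "0 < m" using \<open>0 < \<alpha>\<close> by (simp add: m_def add_pos_nonneg)
    have el: "exp (l (a + b)) = m" using m by (simp add: l_def m_def)
    have e: "exp (b - l (a + b)) = exp b / m" "exp (a + l (a + b)) = exp a * m"
      "exp (- (b - l (a + b))) = m * exp (- b)" "exp (- (a + l (a + b))) = exp (- a) / m"
      by (simp_all add: exp_diff exp_add el exp_minus field_simps)
    \<comment> \<open>Write x', u' for the image of x, u. Then \<open>k1\<close> says 1/x' = 1/u +
      \<alpha> x, and \<open>k2\<close> says \<alpha> x' + 1/u' = 1/x. Hence \<alpha> x + 1/x + 1/u
      is conserved, which explains the parameters \<open>c * \<alpha>\<close>, \<open>c\<close> of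
      the first law and the common \<open>c\<close> of the second.\<close>
    have k1: "m * exp (- b) = exp (- b) + \<alpha> * exp a"
      by (simp add: m_def distrib_right exp_add exp_minus field_simps)
    have "\<alpha> * exp b + exp (- a) = exp (- a) * m"
      by (simp add: m_def exp_add exp_minus field_simps)
    then have k2: "\<alpha> * (exp b / m) + exp (- a) / m = exp (- a)"
      using m by (simp flip: add_divide_distrib)
    have "\<mu>.w (b - l (a + b)) * \<nu>.w (a + l (a + b))
       = exp (- lam * (a + b) - c * (\<alpha> * (exp b / m) + exp (- a) / m) - c * (m * exp (- b)))"
      unfolding \<mu>.w_def \<nu>.w_def e by (simp add: algebra_simps flip: exp_add)
    also have "\<dots> = \<mu>.w a * \<nu>.w b"
      unfolding k1 k2 \<mu>.w_def \<nu>.w_def by (simp add: algebra_simps flip: exp_add)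
    finally have W: "\<mu>.w (b - l (a + b)) * \<nu>.w (a + l (a + b)) = \<mu>.w a * \<nu>.w b" .
    have m': "1 + \<alpha> * exp a * exp b = m" by (simp add: m_def exp_add)
    show ?thesis
      unfolding \<phi>_def fst_conv snd_conv e(1,2) m' using W by simp
  qed
  note eq = this
  have "(\<integral>\<^sup>+x. \<integral>\<^sup>+u. f (u / (1 + \<alpha> * x * u), x * (1 + \<alpha> * x * u)) \<partial>\<nu>.M \<partial>\<mu>.M)
     = (\<integral>\<^sup>+a. \<integral>\<^sup>+b. \<phi> (b - l (a + b), a + l (a + b)) \<partial>lborel \<partial>lborel)"
    unfolding eq[symmetric]
    using both[of "\<lambda>z. f (snd z / (1 + \<alpha> * fst z * snd z), fst z * (1 + \<alpha> * fst z * snd z))"] by simp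
  also have "\<dots> = (\<integral>\<^sup>+a. \<integral>\<^sup>+b. \<phi> (a, b) \<partial>lborel \<partial>lborel)"
    by (rule nn_integral_log_involution) measurable
  also have "\<dots> = (\<integral>\<^sup>+x. \<integral>\<^sup>+u. f (x, u) \<partial>\<nu>.M \<partial>\<mu>.M)"
    by (subst both) (simp_all add: \<phi>_def)
  finally show ?thesis .
qed

lemma invariant_GIG:
  assumes "0 < \<alpha>" "0 < lam" "0 < c" and ln: "2 * (LINT x|GIG lam (c * \<alpha>) c. ln x) < - ln \<alpha>"
  shows "dK_invariant \<alpha> 0 (GIG lam (c * \<alpha>) c)"
proof -
  interpret \<mu>: gig_law lam "c * \<alpha>" c by standard (use assms in auto)
  interpret \<nu>: gig_law lam 0 c by standard (use assms in auto)
  have M: "GIG lam (c * \<alpha>) c = \<mu>.M" by (simp add: GIG_kernel \<mu>.M_def)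
  interpret dK_affine \<alpha> 0 by standard (use assms in auto)
  interpret iid: iid_sequence \<mu>.M using \<mu>.real_distribution_M by (simp add: iid_sequence_def)
  have "stationary_dK \<alpha> 0 \<mu>.M \<nu>.M"
  proof (rule stationary_dKI[OF \<mu>.real_distribution_M \<mu>.AE_M_pos \<nu>.real_distribution_M \<nu>.AE_M_pos])
    show "(\<integral>\<^sup>+x. \<integral>\<^sup>+u. f (Fx x u, Fu x u) \<partial>\<nu>.M \<partial>\<mu>.M) = (\<integral>\<^sup>+x. \<integral>\<^sup>+u. f (x, u) \<partial>\<nu>.M \<partial>\<mu>.M)"
      if "f \<in> borel_measurable (borel \<Otimes>\<^sub>M borel)" for f
      using gig_F_preserves[OF assms(1-3) that] by (simp add: Fx_def Fu_def)
    show "AE x in iid.P. \<forall>n. summable (\<lambda>k. x (n - int k) * (\<Prod>j<k. \<bar>\<alpha> - 0\<bar> * (x (n - int j))\<^sup>2))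
     \<and> (\<lambda>k. \<Prod>j<k. \<bar>\<alpha> - 0\<bar> * (x (n - int j))\<^sup>2) \<longlonglongrightarrow> 0"
      using iid.AE_summable_products[OF assms(1) \<mu>.AE_M_pos \<mu>.integrable_ln _ _ \<mu>.integrable_powr] ln assms(1,2)
      by (simp add: M)
  qed
  then interpret stationary_dK_affine \<alpha> 0 \<mu>.M \<nu>.M
    by (simp add: stationary_dK_affine_def dK_affine_axioms)
  show ?thesis unfolding M by (rule invariant)
qed

text \<open>Exchanging the two coordinates in both source and target turns the map with parameters
  \<beta>, 0 into the one with parameters 0, \<beta>. So \<open>gig_F_preserves\<close> applies
  again, with the roles of configuration and carrier law interchanged.\<close>

lemma invariant_IG:
  assumes "0 < \<beta>" "0 < lam" "0 < c" and ln: "2 * (LINT x|IG lam c. ln x) < - ln \<beta>"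
  shows "dK_invariant 0 \<beta> (IG lam c)"
proof -
  interpret \<mu>: gig_law lam 0 c by standard (use assms in auto)
  interpret \<nu>: gig_law lam "c * \<beta>" c by standard (use assms in auto)
  have M: "IG lam c = \<mu>.M" by (simp add: IG_kernel \<mu>.M_def)
  interpret dK_anti 0 \<beta> by standard (use assms in auto)
  interpret iid: iid_sequence \<mu>.M using \<mu>.real_distribution_M by (simp add: iid_sequence_def)
  interpret \<nu>': real_distribution \<nu>.M by (rule \<nu>.real_distribution_M)
  interpret pair_prob_space \<mu>.M \<nu>.M ..
  have "stationary_dK 0 \<beta> \<mu>.M \<nu>.M"
  proof (rule stationary_dKI[OF \<mu>.real_distribution_M \<mu>.AE_M_pos \<nu>.real_distribution_M \<nu>.AE_M_pos])
    fix f :: "real \<times> real \<Rightarrow> ennreal"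
    assume [measurable]: "f \<in> borel_measurable (borel \<Otimes>\<^sub>M borel)"
    have "(\<integral>\<^sup>+x. \<integral>\<^sup>+u. f (Fx x u, Fu x u) \<partial>\<nu>.M \<partial>\<mu>.M) = (\<integral>\<^sup>+u. \<integral>\<^sup>+x. f (Fx x u, Fu x u) \<partial>\<mu>.M \<partial>\<nu>.M)"
      by (rule Fubini'[symmetric]) measurable
    also have "\<dots> = (\<integral>\<^sup>+u. \<integral>\<^sup>+x. f (x, u) \<partial>\<mu>.M \<partial>\<nu>.M)"
      using gig_F_preserves[OF assms(1-3), of "\<lambda>z. f (snd z, fst z)"]
      by (simp add: Fx_def Fu_def mult_ac)
    also have "\<dots> = (\<integral>\<^sup>+x. \<integral>\<^sup>+u. f (x, u) \<partial>\<nu>.M \<partial>\<mu>.M)"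
      by (rule Fubini') measurable
    finally show "(\<integral>\<^sup>+x. \<integral>\<^sup>+u. f (Fx x u, Fu x u) \<partial>\<nu>.M \<partial>\<mu>.M) = (\<integral>\<^sup>+x. \<integral>\<^sup>+u. f (x, u) \<partial>\<nu>.M \<partial>\<mu>.M)" .
  next
    show "AE x in iid.P. \<forall>n. summable (\<lambda>k. x (n - int k) * (\<Prod>j<k. \<bar>0 - \<beta>\<bar> * (x (n - int j))\<^sup>2))
     \<and> (\<lambda>k. \<Prod>j<k. \<bar>0 - \<beta>\<bar> * (x (n - int j))\<^sup>2) \<longlonglongrightarrow> 0"
      using iid.AE_summable_products[OF assms(1) \<mu>.AE_M_pos \<mu>.integrable_ln _ _ \<mu>.integrable_powr] ln assms(1,2)
      by (simp add: M)
  qed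
  then interpret stationary_dK_anti 0 \<beta> \<mu>.M \<nu>.M
    by (simp add: stationary_dK_anti_def dK_anti_axioms)
  show ?thesis unfolding M by (rule invariant)
qed

theorem theorem3p12:
  fixes \<alpha> \<beta> :: real
  assumes "\<alpha> \<ge> 0" and "\<beta> \<ge> 0"
  shows
    "(\<alpha> = \<beta> \<longrightarrow>
        (\<forall>\<mu>::real measure. prob_space \<mu> \<and> sets \<mu> = sets borel \<and> emeasure \<mu> {0<..} = 1
            \<longrightarrow> dK_invariant \<alpha> \<beta> \<mu>))
     \<and> (\<alpha> > 0 \<and> \<beta> = 0 \<longrightarrow>
        (\<forall>lam c. lam > 0 \<and> c > 0 \<and> 2 * (LINT x|GIG lam (c * \<alpha>) c. ln x) < - ln \<alpha>
            \<longrightarrow> dK_invariant \<alpha> \<beta> (GIG lam (c * \<alpha>) c)))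
     \<and> (\<alpha> = 0 \<and> \<beta> > 0 \<longrightarrow>
        (\<forall>lam c. lam > 0 \<and> c > 0 \<and> 2 * (LINT x|IG lam c. ln x) < - ln \<beta>
            \<longrightarrow> dK_invariant \<alpha> \<beta> (IG lam c)))"
proof (intro conjI impI allI)
  fix \<mu> :: "real measure"
  assume "\<alpha> = \<beta>" and \<mu>: "prob_space \<mu> \<and> sets \<mu> = sets borel \<and> emeasure \<mu> {0<..} = 1"
  then interpret real_distribution \<mu>
    by (simp add: real_distribution_def real_distribution_axioms_def)
  have "AE x in \<mu>. x \<in> {0<..}"
    using \<mu> by (subst AE_in_set_eq_1) (simp_all add: emeasure_eq_measure)
  then have "AE x in \<mu>. 0 < x" by simp
  then show "dK_invariant \<alpha> \<beta> \<mu>"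
    using invariant_equal_parameters[OF assms(1) real_distribution_axioms] \<open>\<alpha> = \<beta>\<close> by simp
qed (use invariant_GIG invariant_IG in auto)

end
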